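(* Let $n,m\ge0$ be integers with $n+m\ge1$, $p\in\mathbb C$, and let $\varrho$ be the Holstein-Primakoff realization of $U_q[sl(n+1|m)]$, i.e. the algebra homomorphism determined by $\varrho(H_i)=p-(-1)^{\theta_i}N_i-N$, $\varrho(a_i^-)=q^{N_1+\cdots+N_{i-1}}\sqrt{\frac{[N_i+1]}{N_i+1}[p-N]}\,c_i^-$, $\varrho(a_i^+)=\bar q^{\,N_1+\cdots+N_{i-1}}\sqrt{\frac{[N_i]}{N_i}[p-N+1]}\,c_i^+$ for $i\in[1;n+m]$. Then the remaining Cartan-Weyl elements $e_{ji}$, $i\ne j\in[1;n+m]$, are realized as $$\varrho(e_{ji})=q^{2\theta_j(N_j-1)+N_{j+1}+N_{j+2}+\cdots+N_{i-1}}\sqrt{\frac{[N_j][N_i+1]}{N_j(N_i+1)}}\;c_j^+c_i^-\qquad(j<i),$$ $$\varrho(e_{ji})=\bar q^{\,2\theta_iN_i+N_{i+1}+N_{i+2}+\cdots+N_{j-1}}\sqrt{\frac{[N_j][N_i+1]}{N_j(N_i+1)}}\;c_j^+c_i^-\qquad(j>i),$$ where empty sums in the exponents are $0$.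
   Context: Notation: $h$ is an indeterminate, $q=e^h$, $\bar q=q^{-1}$, $[x]=\frac{q^x-q^{-x}}{q-q^{-1}}$; $[r;s]=\{r,\dots,s\}$; $\theta_i=0$ for $i\in[0;n]$, $\theta_i=1$ for $i\in[n+1;n+m]$ (integers where needed). For homogeneous $a,b$ in a superalgebra, $[\![a,b]\!]=ab-(-1)^{\deg(a)\deg(b)}ba$. $U_q[sl(n+1|m)]$ is the quantum superalgebra over $\mathbb C[[h]]$ (for the distinguished simple root system) with Cartan-Weyl elements $H_i$ ($i\in[1;n+m]$) and $e_{ij}$ ($i\neq j\in[0;n+m]$, $\deg e_{ij}=\theta_i+\theta_j$). Put $L_i=q^{H_i}$, $\bar L_i=q^{-H_i}$. It is generated by the Jacobson generators $H_i$, $a_i^-=e_{0i}$, $a_i^+=e_{i0}$ ($i\in[1;n+m]$), and the remaining Cartan-Weyl elements $e_{ji}$ ($i\ne j\in[1;n+m]$) are determined by $$[\![a_i^-,a_j^+]\!]=-(-1)^{\theta_i}L_ie_{ji}\ (i<j),\qquad[\![a_i^-,a_j^+]\!]=-(-1)^{\theta_j}e_{ji}\bar L_j\ (i>j).$$ $W(n|m)$ is the ($h$-adically completed) associative superalgebra over $\mathbb C[[h]]$ generated by $c_i^\pm$ ($i\in[1;n+m]$), $\deg(c_i^\pm)=\theta_i$, with relations $[\![c_i^-,c_j^+]\!]=\delta_{ij}$, $[\![c_i^+,c_j^+]\!]=[\![c_i^-,c_j^-]\!]=0$. $N_i=c_i^+c_i^-$, $N=\sum_{j=1}^{n+m}N_j$.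 It acts on the Fock space ${\cal F}(n|m)$ generated by $|0\rangle$ with $c_i^-|0\rangle=0$, with basis $(c_1^+)^{l_1}\cdots(c_{n+m}^+)^{l_{n+m}}|0\rangle$, $l_i\in\mathbb Z_{\ge0}$ for $i\le n$, $l_i\in\{0,1\}$ for $i>n$, on which $N_i$ has eigenvalue $l_i$. The values of $\varrho$ are operators on ${\cal F}(n|m)$; a function $f(N_1,\dots,N_{n+m})$ denotes the diagonal operator with eigenvalues $f(l_1,\dots,l_{n+m})$. Square roots are chosen consistently: fix $s(k)\in\mathbb C[[h]]$ with $s(k)^2=[p-k]$ for each integer $k$, and let $t(x)=\sqrt{[x]/x}$ be the power series in $h$ with constant term $1$, where $\frac{[x]}{x}=\frac{\sinh(hx)}{x\sinh h}\in\mathbb C[x][[h]]$; then $\sqrt{\frac{[N_i+1]}{N_i+1}[p-N]}=t(N_i+1)s(N)$, $\sqrt{\frac{[N_i]}{N_i}[p-N+1]}=t(N_i)s(N-1)$ and $\sqrt{\frac{[N_j][N_i+1]}{N_j(N_i+1)}}=t(N_j)t(N_i+1)$. *)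

theory Defs
  imports
    "HOL-Algebra.QuotRing"
    "HOL-Computational_Algebra.Formal_Power_Series"
    "HOL-Library.Function_Algebras"
begin

section \<open>Scalars: the ring \<open>\<complex>[[h]]\<close>\<close>

text \<open>The indeterminate \<open>h\<close> is \<^const>\<open>fps_X\<close>, and \<open>q\<^sup>x = e\<^sup>h\<^sup>x\<close>.\<close>

definition qpow :: "complex \<Rightarrow> complex fps"
  where "qpow x = fps_exp x"

text \<open>Division of formal power series is exact here: numerator and denominator are both
  divisible by \<open>h\<close>, and the denominator is \<open>2h + \<dots>\<close>.\<close>

definition qnum :: "complex \<Rightarrow> complex fps"
  where "qnum x = (qpow x - qpow (- x)) / (qpow 1 - qpow (- 1))"

text \<open>\<open>sinh (h x) / (h x)\<close>, whose coefficients are polynomials in \<open>x\<close>, so that \<open>x = 0\<close> makes sense.\<close>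

definition sinhc :: "complex \<Rightarrow> complex fps"
  where "sinhc x = Abs_fps (\<lambda>k. if even k then x ^ k / fact (Suc k) else 0)"

definition qratio :: "complex \<Rightarrow> complex fps"
  where "qratio x = sinhc x / sinhc 1"

definition qt :: "complex \<Rightarrow> complex fps"
  where "qt x = (THE t. t\<^sup>2 = qratio x \<and> fps_nth t 0 = 1)"


section \<open>Gradings, signs and the supercommutator\<close>

definition \<theta> :: "nat \<Rightarrow> nat \<Rightarrow> nat"
  where "\<theta> n i = (if n < i then 1 else 0)"

definition sg :: "nat \<Rightarrow> nat \<Rightarrow> complex"
  where "sg n i = (- 1) ^ \<theta> n i"

text \<open>\<open>(-1)\<^sup>d x\<close> and \<open>\<lbrakk>x, y\<rbrakk>\<close> in a ring, for homogeneous \<open>x\<close>, \<open>y\<close> of the given degrees.\<close>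

definition rsign :: "('a, 'b) ring_scheme \<Rightarrow> nat \<Rightarrow> 'a \<Rightarrow> 'a"
  where "rsign R d x = (if even d then x else \<ominus>\<^bsub>R\<^esub> x)"

definition scomm :: "('a, 'b) ring_scheme \<Rightarrow> nat \<Rightarrow> nat \<Rightarrow> 'a \<Rightarrow> 'a \<Rightarrow> 'a"
  where "scomm R d d' x y = x \<otimes>\<^bsub>R\<^esub> y \<ominus>\<^bsub>R\<^esub> rsign R (d * d') (y \<otimes>\<^bsub>R\<^esub> x)"


section \<open>The \<open>h\<close>-adically completed free algebra on Chevalley generators\<close>

text \<open>An element is a family of coefficients indexed by words in the generators
  \<open>h\<^sub>i, e\<^sub>i, f\<^sub>i\<close> with \<open>i \<in> {1..r}\<close>; modulo each power of \<open>h\<close> only finitely many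
  words occur.\<close>

datatype gen = Hg nat | Eg nat | Fg nat

type_synonym fel = "gen list \<Rightarrow> complex fps"

definition gens :: "nat \<Rightarrow> gen set"
  where "gens r = Hg ` {1..r} \<union> Eg ` {1..r} \<union> Fg ` {1..r}"

definition fmul :: "fel \<Rightarrow> fel \<Rightarrow> fel"  (infixl \<open>\<star>\<close> 70)
  where "x \<star> y = (\<lambda>w. \<Sum>k\<le>length w. x (take k w) * y (drop k w))"

definition funit :: fel
  where "funit = (\<lambda>w. if w = [] then 1 else 0)"

definition fgen :: "gen \<Rightarrow> fel"
  where "fgen g = (\<lambda>w. if w = [g] then 1 else 0)"

definition fscale :: "complex fps \<Rightarrow> fel \<Rightarrow> fel"
  where "fscale c x = (\<lambda>w. c * x w)"

definition free_alg :: "nat \<Rightarrow> fel ring"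
  where "free_alg r =
    \<lparr>carrier = {x. (\<forall>w. x w \<noteq> 0 \<longrightarrow> set w \<subseteq> gens r) \<and>
                   (\<forall>k. finite {w. fps_nth (x w) k \<noteq> 0})},
     monoid.mult = (\<star>), one = funit, ring.zero = 0, add = (+)\<rparr>"

definition fpow :: "fel \<Rightarrow> nat \<Rightarrow> fel"
  where "fpow x k = ((\<star>) x ^^ k) funit"

text \<open>\<open>q\<^sup>x = (\<Sum>k. h\<^sup>k x\<^sup>k / k!)\<close>, with the coefficient of \<open>h\<^sup>N\<close> collected word by word.\<close>

definition fqpow :: "fel \<Rightarrow> fel"
  where "fqpow x = (\<lambda>w. Abs_fps (\<lambda>N. \<Sum>k\<le>N. fps_nth (fpow x k w) (N - k) / fact k))"

definition fqnum :: "fel \<Rightarrow> fel"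
  where "fqnum x = (\<lambda>w. (fqpow x w - fqpow (- x) w) / (qpow 1 - qpow (- 1)))"

text \<open>\<open>[x, y]\<^sub>c = x y - c y x\<close>\<close>

definition fcomm :: "complex fps \<Rightarrow> fel \<Rightarrow> fel \<Rightarrow> fel"
  where "fcomm c x y = x \<star> y - fscale c (y \<star> x)"


section \<open>The quantum superalgebra \<open>U\<^sub>q[sl(n+1|m)]\<close>\<close>

text \<open>The Cartan matrix of the distinguished simple root system: the simple root
  vectors are \<open>e\<^sub>i = e\<^sub>i\<^sub>-\<^sub>1\<^sub>,\<^sub>i\<close> and \<open>f\<^sub>i = e\<^sub>i\<^sub>,\<^sub>i\<^sub>-\<^sub>1\<close>, so that only \<open>e\<^sub>n\<^sub>+\<^sub>1\<close>
  and \<open>f\<^sub>n\<^sub>+\<^sub>1\<close> are odd.\<close>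

definition cartan :: "nat \<Rightarrow> nat \<Rightarrow> nat \<Rightarrow> complex"
  where "cartan n i j =
    (if i = j then 1 + sg n (i - 1) * sg n i
     else if j = Suc i then - (sg n (i - 1) * sg n i)
     else if i = Suc j then - 1 else 0)"

definition simple_deg :: "nat \<Rightarrow> nat \<Rightarrow> nat"
  where "simple_deg n i = \<theta> n (i - 1) + \<theta> n i"

inductive_set uq_rels :: "nat \<Rightarrow> nat \<Rightarrow> fel set" for n m :: nat where
  hh: "\<lbrakk>i \<in> {1..n+m}; j \<in> {1..n+m}\<rbrakk> \<Longrightarrow>
    fcomm 1 (fgen (Hg i)) (fgen (Hg j)) \<in> uq_rels n m"
| he: "\<lbrakk>i \<in> {1..n+m}; j \<in> {1..n+m}\<rbrakk> \<Longrightarrow>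
    fcomm 1 (fgen (Hg i)) (fgen (Eg j)) - fscale (fps_const (cartan n i j)) (fgen (Eg j))
      \<in> uq_rels n m"
| hf: "\<lbrakk>i \<in> {1..n+m}; j \<in> {1..n+m}\<rbrakk> \<Longrightarrow>
    fcomm 1 (fgen (Hg i)) (fgen (Fg j)) + fscale (fps_const (cartan n i j)) (fgen (Fg j))
      \<in> uq_rels n m"
| ef: "\<lbrakk>i \<in> {1..n+m}; j \<in> {1..n+m}\<rbrakk> \<Longrightarrow>
    fcomm ((- 1) ^ (simple_deg n i * simple_deg n j)) (fgen (Eg i)) (fgen (Fg j))
      - (if i = j then fqnum (fgen (Hg i)) else 0) \<in> uq_rels n m"
| serre_far: "\<lbrakk>X = Eg \<or> X = Fg; i \<in> {1..n+m}; j \<in> {1..n+m}; i + 2 \<le> j\<rbrakk> \<Longrightarrow>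
    fcomm 1 (fgen (X i)) (fgen (X j)) \<in> uq_rels n m"
| serre_near: "\<lbrakk>X = Eg \<or> X = Fg; i \<in> {1..n+m}; j \<in> {1..n+m}; j = Suc i \<or> i = Suc j;
      i \<noteq> Suc n\<rbrakk> \<Longrightarrow>
    fcomm (qpow 1) (fgen (X i)) (fcomm (qpow (- 1)) (fgen (X i)) (fgen (X j))) \<in> uq_rels n m"
| serre_odd: "\<lbrakk>X = Eg \<or> X = Fg; 1 \<le> m\<rbrakk> \<Longrightarrow>
    fgen (X (n+1)) \<star> fgen (X (n+1)) \<in> uq_rels n m"
| serre_extra: "\<lbrakk>X = Eg \<or> X = Fg; 1 \<le> n; 2 \<le> m\<rbrakk> \<Longrightarrow>
    fcomm (- 1) (fcomm (qpow 1) (fgen (X (n+1))) (fgen (X n)))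
      (fcomm (qpow (- 1)) (fgen (X (n+1))) (fgen (X (n+2)))) \<in> uq_rels n m"

text \<open>The \<open>h\<close>-adic closure of the two-sided ideal generated by the relations.\<close>

definition uq_ideal :: "nat \<Rightarrow> nat \<Rightarrow> fel set"
  where "uq_ideal n m =
    {x \<in> carrier (free_alg (n+m)).
       \<forall>K. \<exists>y \<in> genideal (free_alg (n+m)) (uq_rels n m). \<exists>z \<in> carrier (free_alg (n+m)).
         x = y + fscale (fps_X ^ K) z}"

definition Uq :: "nat \<Rightarrow> nat \<Rightarrow> fel set ring"
  where "Uq n m = free_alg (n+m) Quot uq_ideal n m"

definition ucls :: "nat \<Rightarrow> nat \<Rightarrow> fel \<Rightarrow> fel set"
  where "ucls n m x = uq_ideal n m +>\<^bsub>free_alg (n+m)\<^esub> x"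

definition uscalar :: "nat \<Rightarrow> nat \<Rightarrow> complex fps \<Rightarrow> fel set"
  where "uscalar n m c = ucls n m (fscale c funit)"

text \<open>The Jacobson generators: \<open>H\<^sub>i = (\<Sum>k=1..i. (-1)\<^bsup>\<theta>\<^sub>k\<^sub>-\<^sub>1\<^esup> h\<^sub>k)\<close>, and the root vectors
  \<open>a\<^sub>i\<^sup>- = e\<^sub>0\<^sub>i\<close>, \<open>a\<^sub>i\<^sup>+ = e\<^sub>i\<^sub>0\<close> as iterated \<open>q\<close>-commutators of Chevalley generators
  (at most one entry of each commutator is odd, so no signs arise).\<close>

definition jacH_word :: "nat \<Rightarrow> nat \<Rightarrow> fel"
  where "jacH_word n i = (\<Sum>k=1..i. fscale (fps_const (sg n (k - 1))) (fgen (Hg k)))"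

fun jacm_word :: "nat \<Rightarrow> nat \<Rightarrow> fel" where
  "jacm_word n 0 = 0"
| "jacm_word n (Suc 0) = fgen (Eg 1)"
| "jacm_word n (Suc (Suc i)) =
     fcomm (qpow (- sg n (Suc i))) (jacm_word n (Suc i)) (fgen (Eg (Suc (Suc i))))"

fun jacp_word :: "nat \<Rightarrow> nat \<Rightarrow> fel" where
  "jacp_word n 0 = 0"
| "jacp_word n (Suc 0) = fgen (Fg 1)"
| "jacp_word n (Suc (Suc i)) =
     fcomm (qpow (sg n (Suc i))) (fgen (Fg (Suc (Suc i)))) (jacp_word n (Suc i))"

definition uH :: "nat \<Rightarrow> nat \<Rightarrow> nat \<Rightarrow> fel set"
  where "uH n m i = ucls n m (jacH_word n i)"

definition uL :: "nat \<Rightarrow> nat \<Rightarrow> nat \<Rightarrow> fel set"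
  where "uL n m i = ucls n m (fqpow (jacH_word n i))"

definition uLbar :: "nat \<Rightarrow> nat \<Rightarrow> nat \<Rightarrow> fel set"
  where "uLbar n m i = ucls n m (fqpow (- jacH_word n i))"

definition uam :: "nat \<Rightarrow> nat \<Rightarrow> nat \<Rightarrow> fel set"
  where "uam n m i = ucls n m (jacm_word n i)"

definition uap :: "nat \<Rightarrow> nat \<Rightarrow> nat \<Rightarrow> fel set"
  where "uap n m i = ucls n m (jacp_word n i)"

text \<open>\<open>e j i\<close> are the Cartan-Weyl elements \<open>e\<^sub>j\<^sub>i\<close>, \<open>j \<noteq> i\<close>. The relations determine them,
  because \<open>L\<^sub>i\<close> and \<open>L\<^sub>j\<close> are invertible.\<close>

definition cartan_weyl :: "nat \<Rightarrow> nat \<Rightarrow> (nat \<Rightarrow> nat \<Rightarrow> fel set) \<Rightarrow> bool"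
  where "cartan_weyl n m e \<longleftrightarrow>
    (\<forall>i\<in>{1..n+m}. e 0 i = uam n m i \<and> e i 0 = uap n m i) \<and>
    (\<forall>i\<in>{1..n+m}. \<forall>j\<in>{1..n+m}. i \<noteq> j \<longrightarrow> e j i \<in> carrier (Uq n m)) \<and>
    (\<forall>i\<in>{1..n+m}. \<forall>j\<in>{1..n+m}. i < j \<longrightarrow>
       scomm (Uq n m) (\<theta> n i) (\<theta> n j) (uam n m i) (uap n m j)
         = \<ominus>\<^bsub>Uq n m\<^esub> rsign (Uq n m) (\<theta> n i) (uL n m i \<otimes>\<^bsub>Uq n m\<^esub> e j i)) \<and>
    (\<forall>i\<in>{1..n+m}. \<forall>j\<in>{1..n+m}. j < i \<longrightarrow>
       scomm (Uq n m) (\<theta> n i) (\<theta> n j) (uam n m i) (uap n m j)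
         = \<ominus>\<^bsub>Uq n m\<^esub> rsign (Uq n m) (\<theta> n j) (e j i \<otimes>\<^bsub>Uq n m\<^esub> uLbar n m j))"


section \<open>The Fock space of \<open>W(n|m)\<close> and its operators\<close>

text \<open>A vector is the family of its coordinates in the basis
  \<open>(c\<^sub>1\<^sup>+)\<^bsup>l\<^sub>1\<^esup> \<cdots> (c\<^sub>n\<^sub>+\<^sub>m\<^sup>+)\<^bsup>l\<^sub>n\<^sub>+\<^sub>m\<^esup> |0\<rangle>\<close>. The space is \<open>h\<close>-adically completed, as it has to
  be for the completed algebras to act on it.\<close>

type_synonym fvec = "(nat \<Rightarrow> nat) \<Rightarrow> complex fps"

definition occ :: "nat \<Rightarrow> nat \<Rightarrow> (nat \<Rightarrow> nat) set"
  where "occ n m = {l. (\<forall>i. i \<notin> {1..n+m} \<longrightarrow> l i = 0) \<and> (\<forall>i\<in>{n+1..n+m}. l i \<le> 1)}"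

definition fock :: "nat \<Rightarrow> nat \<Rightarrow> fvec set"
  where "fock n m = {v. (\<forall>l. l \<notin> occ n m \<longrightarrow> v l = 0) \<and> (\<forall>k. finite {l. fps_nth (v l) k \<noteq> 0})}"

definition fvscale :: "complex fps \<Rightarrow> fvec \<Rightarrow> fvec"
  where "fvscale c v = (\<lambda>l. c * v l)"

definition ket :: "(nat \<Rightarrow> nat) \<Rightarrow> fvec"
  where "ket l = (\<lambda>l'. if l' = l then 1 else 0)"

definition fock_End :: "nat \<Rightarrow> nat \<Rightarrow> (fvec \<Rightarrow> fvec) ring"
  where "fock_End n m =
    \<lparr>carrier = {T \<in> fock n m \<rightarrow>\<^sub>E fock n m.
        (\<forall>v\<in>fock n m. \<forall>w\<in>fock n m. T (v + w) = T v + T w) \<and>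
        (\<forall>c. \<forall>v\<in>fock n m. T (fvscale c v) = fvscale c (T v))},
     monoid.mult = compose (fock n m), one = (\<lambda>v\<in>fock n m. v),
     ring.zero = (\<lambda>v\<in>fock n m. 0), add = (\<lambda>S T. \<lambda>v\<in>fock n m. S v + T v)\<rparr>"

text \<open>The diagonal operator \<open>\<phi>(N\<^sub>1, \<dots>, N\<^sub>n\<^sub>+\<^sub>m)\<close>.\<close>

definition diag :: "nat \<Rightarrow> nat \<Rightarrow> ((nat \<Rightarrow> nat) \<Rightarrow> complex fps) \<Rightarrow> fvec \<Rightarrow> fvec"
  where "diag n m \<phi> = (\<lambda>v\<in>fock n m. \<lambda>l. \<phi> l * v l)"

text \<open>The sign from moving \<open>c\<^sub>i\<^sup>\<plusminus>\<close> past \<open>(c\<^sub>1\<^sup>+)\<^bsup>l\<^sub>1\<^esup> \<cdots> (c\<^sub>i\<^sub>-\<^sub>1\<^sup>+)\<^bsup>l\<^sub>i\<^sub>-\<^sub>1\<^esup>\<close>.\<close>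

definition csign :: "nat \<Rightarrow> nat \<Rightarrow> (nat \<Rightarrow> nat) \<Rightarrow> complex fps"
  where "csign n i l = (- 1) ^ (\<theta> n i * (\<Sum>k\<in>{1..<i}. \<theta> n k * l k))"

text \<open>The action of \<open>c\<^sub>i\<^sup>+\<close> and \<open>c\<^sub>i\<^sup>-\<close>, written on coordinates. That these are the operators of
  the Fock representation of \<open>W(n|m)\<close> is shown by \<open>W_rel_diag\<close>, \<open>W_rel_mixed\<close>,
  \<open>W_rel_plus\<close>, \<open>W_rel_minus\<close>, \<open>vacuum\<close> and \<open>basis_monomial\<close> below.\<close>

definition cplus :: "nat \<Rightarrow> nat \<Rightarrow> nat \<Rightarrow> fvec \<Rightarrow> fvec"
  where "cplus n m i = (\<lambda>v\<in>fock n m. \<lambda>l.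
    if l \<in> occ n m \<and> 0 < l i then csign n i l * v (l(i := l i - 1)) else 0)"

definition cminus :: "nat \<Rightarrow> nat \<Rightarrow> nat \<Rightarrow> fvec \<Rightarrow> fvec"
  where "cminus n m i = (\<lambda>v\<in>fock n m. \<lambda>l.
    if l \<in> occ n m then csign n i l * of_nat (l i + 1) * v (l(i := l i + 1)) else 0)"

definition Ntot :: "nat \<Rightarrow> nat \<Rightarrow> (nat \<Rightarrow> nat) \<Rightarrow> nat"
  where "Ntot n m l = (\<Sum>k=1..n+m. l k)"


section \<open>Algebra homomorphisms into the operators on Fock space\<close>

definition fock_rep :: "nat \<Rightarrow> nat \<Rightarrow> (fel set \<Rightarrow> fvec \<Rightarrow> fvec) \<Rightarrow> bool"
  where "fock_rep n m \<rho> \<longleftrightarrow> \<rho> \<in> ring_hom (Uq n m) (fock_End n m) \<and>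
    (\<forall>c. \<rho> (uscalar n m c) = diag n m (\<lambda>_. c))"

text \<open>The defining values of the Holstein-Primakoff realization; \<open>s k\<close> is the chosen square root
  of \<open>[p - k]\<close>.\<close>

definition holstein_primakoff ::
    "nat \<Rightarrow> nat \<Rightarrow> complex \<Rightarrow> (int \<Rightarrow> complex fps) \<Rightarrow> (fel set \<Rightarrow> fvec \<Rightarrow> fvec) \<Rightarrow> bool"
  where "holstein_primakoff n m p s \<rho> \<longleftrightarrow> fock_rep n m \<rho> \<and>
    (\<forall>i\<in>{1..n+m}.
       \<rho> (uH n m i) = diag n m (\<lambda>l. fps_const (p - sg n i * of_nat (l i) - of_nat (Ntot n m l))) \<and>
       \<rho> (uam n m i) =
         diag n m (\<lambda>l. qpow (of_nat (\<Sum>k\<in>{1..<i}. l k)) * (qt (of_nat (l i + 1)) * s (int (Ntot n m l))))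
           \<otimes>\<^bsub>fock_End n m\<^esub> cminus n m i \<and>
       \<rho> (uap n m i) =
         diag n m (\<lambda>l. qpow (- of_nat (\<Sum>k\<in>{1..<i}. l k)) * (qt (of_nat (l i)) * s (int (Ntot n m l) - 1)))
           \<otimes>\<^bsub>fock_End n m\<^esub> cplus n m i)"

section \<open>Well-definedness of the constructions\<close>

subsection \<open>The free algebra is a ring, and the closed relation ideal is an ideal\<close>

lemma free_alg_simps:
  "x \<otimes>\<^bsub>free_alg r\<^esub> y = x \<star> y" "x \<oplus>\<^bsub>free_alg r\<^esub> y = x + y"
  "\<one>\<^bsub>free_alg r\<^esub> = funit" "\<zero>\<^bsub>free_alg r\<^esub> = 0"
  by (simp_all add: free_alg_def)

lemma free_alg_carrier:
  "x \<in> carrier (free_alg r) \<longleftrightarrow> (\<forall>w. x w \<noteq> 0 \<longrightarrow> set w \<subseteq> gens r) \<and>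
    (\<forall>k. finite {w. fps_nth (x w) k \<noteq> 0})"
  by (simp add: free_alg_def)

lemma fscale_carrier: "x \<in> carrier (free_alg r) \<Longrightarrow> fscale c x \<in> carrier (free_alg r)"
proof -
  assume x: "x \<in> carrier (free_alg r)"
  have "{w. fps_nth (fscale c x w) k \<noteq> 0} \<subseteq> (\<Union>j\<in>{..k}. {w. fps_nth (x w) j \<noteq> 0})" for k
  proof
    fix w assume "w \<in> {w. fps_nth (fscale c x w) k \<noteq> 0}"
    then have "(\<Sum>j=0..k. fps_nth c j * fps_nth (x w) (k - j)) \<noteq> 0" by (simp add: fscale_def fps_mult_nth)
    then obtain j where "j \<in> {0..k}" "fps_nth c j * fps_nth (x w) (k - j) \<noteq> 0"
      by (rule sum.not_neutral_contains_not_neutral)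
    then show "w \<in> (\<Union>j\<in>{..k}. {w. fps_nth (x w) j \<noteq> 0})" by (auto intro!: bexI[of _ "k - j"])
  qed
  moreover have "finite (\<Union>j\<in>{..k}. {w. fps_nth (x w) j \<noteq> 0})" for k
    using x by (auto simp: free_alg_carrier)
  ultimately have "finite {w. fps_nth (fscale c x w) k \<noteq> 0}" for k by (rule finite_subset)
  then show ?thesis using x by (auto simp: free_alg_carrier fscale_def)
qed

lemma fmul_carrier:
  assumes x: "x \<in> carrier (free_alg r)" and y: "y \<in> carrier (free_alg r)"
  shows "x \<star> y \<in> carrier (free_alg r)"
proof -
  have "{w. fps_nth ((x \<star> y) w) k \<noteq> 0} \<subseteq> (\<lambda>(u, v). u @ v) `
      ((\<Union>j\<in>{..k}. {w. fps_nth (x w) j \<noteq> 0}) \<times> (\<Union>j\<in>{..k}. {w. fps_nth (y w) j \<noteq> 0}))" (is "_ \<subseteq> _ ` ?S") for k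
  proof
    fix w assume "w \<in> {w. fps_nth ((x \<star> y) w) k \<noteq> 0}"
    then have "(\<Sum>i\<le>length w. \<Sum>j=0..k. fps_nth (x (take i w)) j * fps_nth (y (drop i w)) (k - j)) \<noteq> 0"
      by (simp add: fmul_def fps_sum_nth fps_mult_nth)
    then obtain i where "(\<Sum>j=0..k. fps_nth (x (take i w)) j * fps_nth (y (drop i w)) (k - j)) \<noteq> 0"
      by (rule sum.not_neutral_contains_not_neutral)
    then obtain j where "j \<in> {0..k}" "fps_nth (x (take i w)) j * fps_nth (y (drop i w)) (k - j) \<noteq> 0"
      by (rule sum.not_neutral_contains_not_neutral)
    then have "(take i w, drop i w) \<in> ?S"
      by (auto intro: bexI[of _ j] bexI[of _ "k - j"])
    then show "w \<in> (\<lambda>(u, v). u @ v) ` ?S" by (rule rev_image_eqI) simp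
  qed
  moreover have "finite ((\<lambda>(u, v). u @ v) `
      ((\<Union>j\<in>{..k}. {w. fps_nth (x w) j \<noteq> 0}) \<times> (\<Union>j\<in>{..k}. {w. fps_nth (y w) j \<noteq> 0})))" for k
    using x y by (intro finite_imageI finite_cartesian_product) (auto simp: free_alg_carrier)
  ultimately have "finite {w. fps_nth ((x \<star> y) w) k \<noteq> 0}" for k by (rule finite_subset)
  moreover have "set w \<subseteq> gens r" if "(x \<star> y) w \<noteq> 0" for w
  proof -
    have "(\<Sum>k\<le>length w. x (take k w) * y (drop k w)) \<noteq> 0"
      using that by (simp add: fmul_def)
    then obtain i where "x (take i w) * y (drop i w) \<noteq> 0"
      by (rule sum.not_neutral_contains_not_neutral)
    then have "set (take i w) \<subseteq> gens r" "set (drop i w) \<subseteq> gens r"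
      using x y by (auto simp: free_alg_carrier)
    then show ?thesis by (metis append_take_drop_id set_append Un_least)
  qed
  ultimately show ?thesis by (simp add: free_alg_carrier)
qed

lemma fmul_assoc: "(x \<star> y) \<star> z = x \<star> (y \<star> z)"
proof
  fix w :: "gen list"
  let ?L = "length w"
  have "((x \<star> y) \<star> z) w =
      (\<Sum>k\<le>?L. \<Sum>j\<le>k. x (take j w) * y (drop j (take k w)) * z (drop k w))"
    by (auto simp: fmul_def sum_distrib_right min_def intro!: sum.cong)
  also have "\<dots> = (\<Sum>(k, j)\<in>(SIGMA k:{..?L}. {..k}). x (take j w) * y (drop j (take k w)) * z (drop k w))"
    by (rule sum.Sigma) auto
  also have "\<dots> = (\<Sum>(j, i)\<in>(SIGMA j:{..?L}. {..?L - j}).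
      x (take j w) * y (drop j (take (j + i) w)) * z (drop (j + i) w))"
    by (rule sum.reindex_bij_witness[where i = "\<lambda>(j, i). (j + i, j)" and j = "\<lambda>(k, j). (j, k - j)"]) auto
  also have "\<dots> = (\<Sum>j\<le>?L. \<Sum>i\<le>?L - j.
      x (take j w) * y (drop j (take (j + i) w)) * z (drop (j + i) w))"
    by (rule sum.Sigma[symmetric]) auto
  also have "\<dots> = (x \<star> (y \<star> z)) w"
    by (auto simp: fmul_def sum_distrib_left mult.assoc drop_take add.commute intro!: sum.cong)
  finally show "((x \<star> y) \<star> z) w = (x \<star> (y \<star> z)) w" .
qed

lemma fmul_unit: "funit \<star> x = x" "x \<star> funit = x"
proof -
  have "(\<Sum>k\<le>length w. (if k = 0 then x w else 0)) = x w" for w :: "gen list"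
    by (simp add: sum.delta)
  moreover have "(funit \<star> x) w = (\<Sum>k\<le>length w. (if k = 0 then x w else 0))" for w
    unfolding fmul_def by (intro sum.cong) (auto simp: funit_def)
  ultimately show "funit \<star> x = x" by auto
  have "(\<Sum>k\<le>length w. (if k = length w then x w else 0)) = x w" for w :: "gen list"
    by (simp add: sum.delta)
  moreover have "(x \<star> funit) w = (\<Sum>k\<le>length w. (if k = length w then x w else 0))" for w
    unfolding fmul_def by (intro sum.cong) (auto simp: funit_def)
  ultimately show "x \<star> funit = x" by auto
qed

lemma fmul_scale: "fscale c x \<star> y = fscale c (x \<star> y)" "x \<star> fscale c y = fscale c (x \<star> y)"
  by (simp_all add: fun_eq_iff fmul_def fscale_def sum_distrib_left mult.assoc mult.left_commute)

lemma fadd_carrier: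
  assumes x: "x \<in> carrier (free_alg r)" and y: "y \<in> carrier (free_alg r)"
  shows "x + y \<in> carrier (free_alg r)"
proof -
  have "{w. fps_nth ((x + y) w) k \<noteq> 0} \<subseteq> {w. fps_nth (x w) k \<noteq> 0} \<union> {w. fps_nth (y w) k \<noteq> 0}" for k
    by auto
  moreover have "finite ({w. fps_nth (x w) k \<noteq> 0} \<union> {w. fps_nth (y w) k \<noteq> 0})" for k
    using x y by (simp add: free_alg_carrier)
  ultimately have "finite {w. fps_nth ((x + y) w) k \<noteq> 0}" for k by (rule finite_subset)
  moreover have "set w \<subseteq> gens r" if "(x + y) w \<noteq> 0" for w
  proof -
    from that have "x w \<noteq> 0 \<or> y w \<noteq> 0" by auto
    then show ?thesis using x y unfolding free_alg_carrier by blast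
  qed
  ultimately show ?thesis by (simp add: free_alg_carrier)
qed

lemma ring_free_alg: "ring (free_alg r)"
proof (rule ringI)
  show "abelian_group (free_alg r)"
  proof (rule abelian_groupI)
    fix x assume x: "x \<in> carrier (free_alg r)"
    have "fscale (- 1) x + x = 0" by (simp add: fscale_def fun_eq_iff)
    then show "\<exists>y\<in>carrier (free_alg r). y \<oplus>\<^bsub>free_alg r\<^esub> x = \<zero>\<^bsub>free_alg r\<^esub>"
      using fscale_carrier[OF x] by (auto simp: free_alg_simps)
  qed (simp_all add: free_alg_simps fadd_carrier add.assoc, simp_all add: free_alg_carrier add.commute)
  show "Group.monoid (free_alg r)"
  proof (rule monoidI)
    have "{w. fps_nth (funit w) k \<noteq> 0} \<subseteq> {[]}" for k by (auto simp: funit_def)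
    then have "finite {w. fps_nth (funit w) k \<noteq> 0}" for k by (rule finite_subset) simp
    then show "\<one>\<^bsub>free_alg r\<^esub> \<in> carrier (free_alg r)"
      unfolding free_alg_simps free_alg_carrier by (auto simp: funit_def)
  qed (simp_all add: free_alg_simps fmul_carrier fmul_assoc fmul_unit)
qed (simp_all add: free_alg_simps fmul_def fun_eq_iff sum.distrib algebra_simps)

lemma fqpow_carrier:
  assumes x: "x \<in> carrier (free_alg r)"
  shows "fqpow x \<in> carrier (free_alg r)"
proof -
  interpret ring "free_alg r" by (rule ring_free_alg)
  have p: "fpow x k \<in> carrier (free_alg r)" for k
    using one_closed by (induction k) (auto simp: fpow_def free_alg_simps fmul_carrier x)
  have "{w. fps_nth (fqpow x w) N \<noteq> 0} \<subseteq> (\<Union>k\<in>{..N}. {w. fps_nth (fpow x k w) (N - k) \<noteq> 0})" for N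
  proof
    fix w assume "w \<in> {w. fps_nth (fqpow x w) N \<noteq> 0}"
    then have "(\<Sum>k\<le>N. fps_nth (fpow x k w) (N - k) / fact k) \<noteq> 0" by (simp add: fqpow_def)
    then obtain k where "k \<in> {..N}" "fps_nth (fpow x k w) (N - k) / fact k \<noteq> 0" by (rule sum.not_neutral_contains_not_neutral)
    then show "w \<in> (\<Union>k\<in>{..N}. {w. fps_nth (fpow x k w) (N - k) \<noteq> 0})" by auto
  qed
  moreover have "finite (\<Union>k\<in>{..N}. {w. fps_nth (fpow x k w) (N - k) \<noteq> 0})" for N
    using p by (auto simp: free_alg_carrier)
  ultimately have "finite {w. fps_nth (fqpow x w) N \<noteq> 0}" for N by (rule finite_subset)
  moreover have "set w \<subseteq> gens r" if "fqpow x w \<noteq> 0" for w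
  proof (rule ccontr)
    assume "\<not> set w \<subseteq> gens r"
    then have "fpow x k w = 0" for k using p[of k] unfolding free_alg_carrier by blast
    then have "fqpow x w = 0" by (simp add: fqpow_def fps_eq_iff)
    with that show False by simp
  qed
  ultimately show ?thesis by (simp add: free_alg_carrier)
qed

lemma fgen_carrier: "g \<in> gens r \<Longrightarrow> fgen g \<in> carrier (free_alg r)"
proof -
  assume g: "g \<in> gens r"
  have "{w. fps_nth (fgen g w) k \<noteq> 0} \<subseteq> {[g]}" for k by (auto simp: fgen_def)
  then have "finite {w. fps_nth (fgen g w) k \<noteq> 0}" for k by (rule finite_subset) simp
  then show ?thesis using g by (auto simp: free_alg_carrier fgen_def)
qed

text \<open>The two divisions are exact.\<close>

lemma qden: "fps_X * fps_shift 1 (qpow 1 - qpow (- 1)) = qpow 1 - qpow (- 1)"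
  "fps_nth (fps_shift 1 (qpow 1 - qpow (- 1))) 0 = 2"
  by (simp_all add: qpow_def fps_eq_iff)

lemma qden_dvd: "fps_nth a 0 = 0 \<Longrightarrow> (a / (qpow 1 - qpow (- 1))) * (qpow 1 - qpow (- 1)) = a"
proof -
  assume a: "fps_nth a 0 = 0"
  have nz: "fps_nth (qpow 1 - qpow (- 1)) 1 \<noteq> 0" by (simp add: qpow_def)
  then have "subdegree (qpow 1 - qpow (- 1)) = 1"
    by (intro subdegreeI) (auto simp: qpow_def)
  moreover have "a = 0 \<or> 1 \<le> subdegree a"
    using a by (metis One_nat_def Suc_leI gr0I nth_subdegree_nonzero)
  moreover have "qpow 1 - qpow (- 1) \<noteq> 0" using nz by (metis fps_zero_nth)
  ultimately have "qpow 1 - qpow (- 1) dvd a" by (cases "a = 0") (simp_all add: fps_dvd_iff)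
  then show ?thesis by simp
qed

lemma qnum_mult: "qnum x * (qpow 1 - qpow (- 1)) = qpow x - qpow (- x)"
  unfolding qnum_def by (rule qden_dvd) (simp add: qpow_def)

lemma fqnum_mult: "fscale (qpow 1 - qpow (- 1)) (fqnum x) = fqpow x - fqpow (- x)"
proof
  fix w
  have "fps_nth (fqpow x w - fqpow (- x) w) 0 = 0" by (simp add: fqpow_def fpow_def)
  from qden_dvd[OF this] show "fscale (qpow 1 - qpow (- 1)) (fqnum x) w = (fqpow x - fqpow (- x)) w"
    by (simp add: fscale_def fqnum_def mult.commute)
qed

lemma sinhc_exp: "fps_const 2 * fps_X * fps_const x * sinhc x = qpow x - qpow (- x)"
proof (rule fps_ext)
  fix k show "fps_nth (fps_const 2 * fps_X * fps_const x * sinhc x) k = fps_nth (qpow x - qpow (- x)) k"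
  proof (cases k)
    case (Suc j)
    then show ?thesis
      by (cases "even j") (simp_all add: sinhc_def qpow_def mult.assoc divide_simps del: fact_Suc)
  qed (simp add: qpow_def mult.assoc)
qed

lemma qratio_qnum: "fps_const x * qratio x = qnum x"
proof -
  let ?d = "qpow 1 - qpow (- 1)"
  have u: "fps_nth (sinhc 1) 0 \<noteq> 0" by (simp add: sinhc_def)
  then have d: "qratio x * sinhc 1 = sinhc x" unfolding qratio_def
    by (metis dvd_div_mult_self fps_is_unit_iff unit_imp_dvd)
  have nz: "?d \<noteq> 0"
  proof
    assume "?d = 0"
    then have "fps_nth ?d 1 = 0" by simp
    then show False by (simp add: qpow_def)
  qed
  have "fps_const x * qratio x * ?d = fps_const 2 * fps_X * fps_const x * (qratio x * sinhc 1)"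
    unfolding sinhc_exp[of 1, symmetric] by (simp add: mult.commute mult.left_commute)
  also have "\<dots> = qnum x * ?d" unfolding d qnum_mult by (rule sinhc_exp)
  finally show ?thesis using nz by simp
qed

lemma qt: "(qt x)\<^sup>2 = qratio x \<and> fps_nth (qt x) 0 = 1"
proof -
  have r0: "fps_nth (qratio x) 0 = 1"
    by (simp add: qratio_def sinhc_def fps_divide_unit)
  let ?t = "fps_radical (\<lambda>_ _. 1) 2 (qratio x)"
  have t: "?t ^ Suc 1 = qratio x"
    using power_radical[of "qratio x" "\<lambda>_ _. 1" 1] r0 by (simp add: numeral_2_eq_2)
  have t0: "fps_nth ?t 0 = 1" by simp
  show ?thesis unfolding qt_def
  proof (rule theI[of _ ?t])
    show "?t\<^sup>2 = qratio x \<and> fps_nth ?t 0 = 1" using t t0 by (simp add: numeral_2_eq_2)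
    fix u assume u: "u\<^sup>2 = qratio x \<and> fps_nth u 0 = 1"
    have "u\<^sup>2 = ?t\<^sup>2" using u t by (simp add: numeral_2_eq_2)
    then have "u = ?t \<or> u = - ?t" by (rule power2_eq_iff[THEN iffD1])
    moreover have "u \<noteq> - ?t"
    proof
      assume "u = - ?t"
      then have "fps_nth u 0 = - fps_nth ?t 0" by simp
      then show False using u t0 by simp
    qed
    ultimately show "u = ?t" by blast
  qed
qed

lemma fcomm_carrier:
  "x \<in> carrier (free_alg r) \<Longrightarrow> y \<in> carrier (free_alg r) \<Longrightarrow> fcomm c x y \<in> carrier (free_alg r)"
proof -
  assume x: "x \<in> carrier (free_alg r)" and y: "y \<in> carrier (free_alg r)"
  have "fcomm c x y = x \<star> y + fscale (- c) (y \<star> x)"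
    by (simp add: fcomm_def fscale_def fun_eq_iff)
  then show ?thesis using x y by (simp add: fadd_carrier fscale_carrier fmul_carrier)
qed

lemma fdiff_carrier:
  "x \<in> carrier (free_alg r) \<Longrightarrow> y \<in> carrier (free_alg r) \<Longrightarrow> x - y \<in> carrier (free_alg r)"
proof -
  assume x: "x \<in> carrier (free_alg r)" and y: "y \<in> carrier (free_alg r)"
  have eq: "x - y = x + fscale (- 1) y" by (simp add: fscale_def fun_eq_iff)
  show ?thesis unfolding eq by (rule fadd_carrier[OF x fscale_carrier[OF y]])
qed

lemma fqnum_carrier:
  assumes x: "x \<in> carrier (free_alg r)"
  shows "fqnum x \<in> carrier (free_alg r)"
proof -
  let ?d = "qpow 1 - qpow (- 1)" and ?u = "fps_shift 1 (qpow 1 - qpow (- 1))"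
  have "- x = fscale (- 1) x" by (simp add: fscale_def fun_eq_iff)
  then have y: "fqpow x - fqpow (- x) \<in> carrier (free_alg r)"
    using x by (simp add: fdiff_carrier fqpow_carrier fscale_carrier)
  then have uy: "fscale (inverse ?u) (fqpow x - fqpow (- x)) \<in> carrier (free_alg r)"
    by (rule fscale_carrier)
  have "fps_nth (fscale (inverse ?u) (fqpow x - fqpow (- x)) w) (Suc k) = fps_nth (fqnum x w) k" for w k
  proof -
    have "fscale (inverse ?u) (fqpow x - fqpow (- x)) w = inverse ?u * (?d * fqnum x w)"
      unfolding fqnum_mult[symmetric] by (simp add: fscale_def)
    also have "\<dots> = (inverse ?u * ?u) * (fps_X * fqnum x w)"
      by (subst qden(1)[symmetric]) (simp only: ac_simps)
    also have "inverse ?u * ?u = 1" using qden(2) by (intro inverse_mult_eq_1) simp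
    finally show ?thesis by (simp only: fps_X_mult_nth mult_1_left) simp
  qed
  then have "{w. fps_nth (fqnum x w) k \<noteq> 0} =
      {w. fps_nth (fscale (inverse ?u) (fqpow x - fqpow (- x)) w) (Suc k) \<noteq> 0}" for k by simp
  then have "finite {w. fps_nth (fqnum x w) k \<noteq> 0}" for k
    using uy unfolding free_alg_carrier by simp
  moreover have "set w \<subseteq> gens r" if "fqnum x w \<noteq> 0" for w
  proof -
    have "(fqpow x - fqpow (- x)) w \<noteq> 0" using that by (auto simp: fqnum_def)
    then show ?thesis using y unfolding free_alg_carrier by blast
  qed
  ultimately show ?thesis by (simp add: free_alg_carrier)
qed

lemma uq_rels_carrier: "uq_rels n m \<subseteq> carrier (free_alg (n+m))"
proof
  have g: "\<And>i. i \<in> {1..n+m} \<Longrightarrow> fgen (Hg i) \<in> carrier (free_alg (n+m))"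
    "\<And>X i. X = Eg \<or> X = Fg \<Longrightarrow> i \<in> {1..n+m} \<Longrightarrow> fgen (X i) \<in> carrier (free_alg (n+m))"
    by (auto intro!: fgen_carrier simp: gens_def)
  have z: "0 \<in> carrier (free_alg (n+m))" by (simp add: free_alg_carrier)
  fix x assume "x \<in> uq_rels n m"
  then show "x \<in> carrier (free_alg (n+m))"
    by (cases rule: uq_rels.cases)
      (auto intro!: fcomm_carrier fdiff_carrier fadd_carrier fscale_carrier fmul_carrier fqnum_carrier g z)
qed

lemma uq_ideal: "ideal (uq_ideal n m) (free_alg (n+m))"
proof -
  let ?A = "free_alg (n+m)" and ?I = "genideal (free_alg (n+m)) (uq_rels n m)"
  interpret ring ?A by (rule ring_free_alg)
  interpret I: ideal ?I ?A by (rule genideal_ideal[OF uq_rels_carrier])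
  have fs: "fscale c (x + y) = fscale c x + fscale c y" for c x y
    by (simp add: fscale_def fun_eq_iff distrib_left)
  have neg: "\<ominus>\<^bsub>?A\<^esub> x = fscale (- 1) x" if "x \<in> carrier ?A" for x
    using fscale_carrier[OF that, of "- 1"] that
    by (intro minus_equality) (simp_all add: free_alg_simps, simp add: fscale_def fun_eq_iff)
  show ?thesis
  proof (rule idealI)
    show "ring ?A" by (rule ring_free_alg)
    show "subgroup (uq_ideal n m) (add_monoid ?A)"
    proof (rule add.subgroupI)
      show "uq_ideal n m \<subseteq> carrier ?A" by (auto simp: uq_ideal_def)
      have "\<zero>\<^bsub>?A\<^esub> = \<zero>\<^bsub>?A\<^esub> + fscale (fps_X ^ K) \<zero>\<^bsub>?A\<^esub>" for K
        by (simp add: free_alg_simps fscale_def fun_eq_iff)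
      then have "\<zero>\<^bsub>?A\<^esub> \<in> uq_ideal n m"
        unfolding uq_ideal_def using zero_closed I.zero_closed by blast
      then show "uq_ideal n m \<noteq> {}" by blast
    next
      fix a assume a: "a \<in> uq_ideal n m"
      then have ac: "a \<in> carrier ?A" by (simp add: uq_ideal_def)
      have "\<exists>y\<in>?I. \<exists>z\<in>carrier ?A. \<ominus>\<^bsub>?A\<^esub> a = y + fscale (fps_X ^ K) z" for K
      proof -
        obtain y z where y: "y \<in> ?I" and z: "z \<in> carrier ?A" and e: "a = y + fscale (fps_X ^ K) z"
          using a unfolding uq_ideal_def by blast
        have "\<ominus>\<^bsub>?A\<^esub> a = \<ominus>\<^bsub>?A\<^esub> y + fscale (fps_X ^ K) (fscale (- 1) z)"
          unfolding neg[OF ac] neg[OF I.Icarr[OF y]] by (simp add: e fscale_def fun_eq_iff)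
        then show ?thesis using I.a_inv_closed[OF y] fscale_carrier[OF z] by blast
      qed
      then show "\<ominus>\<^bsub>?A\<^esub> a \<in> uq_ideal n m" using ac by (simp add: uq_ideal_def)
    next
      fix a b assume a: "a \<in> uq_ideal n m" and b: "b \<in> uq_ideal n m"
      have "\<exists>y\<in>?I. \<exists>z\<in>carrier ?A. a \<oplus>\<^bsub>?A\<^esub> b = y + fscale (fps_X ^ K) z" for K
      proof -
        obtain y z where y: "y \<in> ?I" and z: "z \<in> carrier ?A" and e: "a = y + fscale (fps_X ^ K) z"
          using a unfolding uq_ideal_def by blast
        obtain y' z' where y': "y' \<in> ?I" and z': "z' \<in> carrier ?A" and e': "b = y' + fscale (fps_X ^ K) z'"
          using b unfolding uq_ideal_def by blast
        have "a \<oplus>\<^bsub>?A\<^esub> b = (y \<oplus>\<^bsub>?A\<^esub> y') + fscale (fps_X ^ K) (z + z')"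
          unfolding e e' free_alg_simps fs by (simp add: ac_simps)
        then show ?thesis using I.a_closed[OF y y'] fadd_carrier[OF z z'] by blast
      qed
      then show "a \<oplus>\<^bsub>?A\<^esub> b \<in> uq_ideal n m" using a b by (simp add: uq_ideal_def)
    qed
  next
    fix a x assume a: "a \<in> uq_ideal n m" and x: "x \<in> carrier ?A"
    have dist: "x \<star> (u + v) = x \<star> u + x \<star> v" "(u + v) \<star> x = u \<star> x + v \<star> x" for u v
      by (simp_all add: fmul_def fun_eq_iff sum.distrib algebra_simps)
    have "(\<exists>y\<in>?I. \<exists>z\<in>carrier ?A. x \<otimes>\<^bsub>?A\<^esub> a = y + fscale (fps_X ^ K) z) \<and>
        (\<exists>y\<in>?I. \<exists>z\<in>carrier ?A. a \<otimes>\<^bsub>?A\<^esub> x = y + fscale (fps_X ^ K) z)" for K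
    proof -
      obtain y z where y: "y \<in> ?I" and z: "z \<in> carrier ?A" and e: "a = y + fscale (fps_X ^ K) z"
        using a unfolding uq_ideal_def by blast
      have "x \<otimes>\<^bsub>?A\<^esub> a = x \<otimes>\<^bsub>?A\<^esub> y + fscale (fps_X ^ K) (x \<star> z)"
        "a \<otimes>\<^bsub>?A\<^esub> x = y \<otimes>\<^bsub>?A\<^esub> x + fscale (fps_X ^ K) (z \<star> x)"
        unfolding e free_alg_simps by (simp_all add: dist fmul_scale)
      then show ?thesis
        using I.I_l_closed[OF y x] I.I_r_closed[OF y x] fmul_carrier[OF x z] fmul_carrier[OF z x] by blast
    qed
    then show "x \<otimes>\<^bsub>?A\<^esub> a \<in> uq_ideal n m" "a \<otimes>\<^bsub>?A\<^esub> x \<in> uq_ideal n m"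
      using a x by (simp_all add: uq_ideal_def)
  qed
qed

lemma ring_Uq: "ring (Uq n m)"
  unfolding Uq_def by (rule ideal.quotient_is_ring[OF uq_ideal])

subsection \<open>The operators form a ring\<close>

lemma fock_zero_off: "v \<in> fock n m \<Longrightarrow> l \<notin> occ n m \<Longrightarrow> v l = 0"
  by (simp add: fock_def)

lemma fock_add: "v \<in> fock n m \<Longrightarrow> w \<in> fock n m \<Longrightarrow> v + w \<in> fock n m"
proof -
  assume v: "v \<in> fock n m" and w: "w \<in> fock n m"
  have "{l. fps_nth ((v + w) l) k \<noteq> 0} \<subseteq> {l. fps_nth (v l) k \<noteq> 0} \<union> {l. fps_nth (w l) k \<noteq> 0}" for k
    by auto
  moreover have "finite ({l. fps_nth (v l) k \<noteq> 0} \<union> {l. fps_nth (w l) k \<noteq> 0})" for k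
    using v w by (simp add: fock_def)
  ultimately have "finite {l. fps_nth ((v + w) l) k \<noteq> 0}" for k
    by (rule finite_subset)
  then show ?thesis using v w by (auto simp: fock_def)
qed

lemma fock_zero: "0 \<in> fock n m"
  by (simp add: fock_def)

text \<open>Multiplying coordinates by scalars and moving them along a map that is injective on the
  relevant basis vectors preserves the Fock space.\<close>

lemma fock_reindex:
  assumes v: "v \<in> fock n m" and S: "S \<subseteq> occ n m" and inj: "inj_on g S"
  shows "(\<lambda>l. if l \<in> S then \<phi> l * v (g l) else 0) \<in> fock n m"
proof -
  have "finite {l. fps_nth (if l \<in> S then \<phi> l * v (g l) else 0) k \<noteq> 0}" for k
  proof -
    let ?B = "\<Union>j\<in>{..k}. {l. fps_nth (v l) j \<noteq> 0}"
    have fin: "finite ?B" using v by (auto simp: fock_def)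
    have "{l. fps_nth (if l \<in> S then \<phi> l * v (g l) else 0) k \<noteq> 0} \<subseteq> {l \<in> S. g l \<in> ?B}"
    proof
      fix l assume "l \<in> {l. fps_nth (if l \<in> S then \<phi> l * v (g l) else 0) k \<noteq> 0}"
      then have l: "l \<in> S" "fps_nth (\<phi> l * v (g l)) k \<noteq> 0" by (auto split: if_splits)
      then obtain j where "j \<le> k" "fps_nth (v (g l)) j \<noteq> 0"
      proof -
        have "\<exists>j\<le>k. fps_nth (v (g l)) j \<noteq> 0"
        proof (rule ccontr)
          assume "\<not> ?thesis"
          then have "fps_nth (\<phi> l * v (g l)) k = 0" by (auto simp: fps_mult_nth)
          with l show False by simp
        qed
        then show ?thesis using that by blast
      qed
      then show "l \<in> {l \<in> S. g l \<in> ?B}" using l by auto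
    qed
    moreover have "finite {l \<in> S. g l \<in> ?B}"
    proof -
      have "inj_on g {l \<in> S. g l \<in> ?B}" using inj by (rule inj_on_subset) auto
      moreover have "finite (g ` {l \<in> S. g l \<in> ?B})" by (rule finite_subset[OF _ fin]) auto
      ultimately show ?thesis using finite_imageD by blast
    qed
    ultimately show ?thesis by (rule finite_subset)
  qed
  then show ?thesis using S by (auto simp: fock_def)
qed

lemma fock_diag: "v \<in> fock n m \<Longrightarrow> (\<lambda>l. \<phi> l * v l) \<in> fock n m"
proof -
  assume v: "v \<in> fock n m"
  have "(\<lambda>l. if l \<in> occ n m then \<phi> l * v l else 0) = (\<lambda>l. \<phi> l * v l)"
    using v by (auto simp: fock_def)
  then show ?thesis using fock_reindex[OF v subset_refl, of "\<lambda>l. l" \<phi>] by simp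
qed

lemma fvscale_closed: "v \<in> fock n m \<Longrightarrow> fvscale c v \<in> fock n m"
  unfolding fvscale_def by (rule fock_diag)

lemma fock_EndI:
  assumes "T \<in> extensional (fock n m)" "\<And>v. v \<in> fock n m \<Longrightarrow> T v \<in> fock n m"
    "\<And>v w. v \<in> fock n m \<Longrightarrow> w \<in> fock n m \<Longrightarrow> T (v + w) = T v + T w"
    "\<And>c v. v \<in> fock n m \<Longrightarrow> T (fvscale c v) = fvscale c (T v)"
  shows "T \<in> carrier (fock_End n m)"
  using assms by (auto simp: fock_End_def PiE_def)

lemma fock_EndD:
  assumes "T \<in> carrier (fock_End n m)"
  shows "T \<in> extensional (fock n m)" "\<And>v. v \<in> fock n m \<Longrightarrow> T v \<in> fock n m"
    "\<And>v w. v \<in> fock n m \<Longrightarrow> w \<in> fock n m \<Longrightarrow> T (v + w) = T v + T w"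
    "\<And>c v. v \<in> fock n m \<Longrightarrow> T (fvscale c v) = fvscale c (T v)"
  using assms by (auto simp: fock_End_def PiE_def)

lemma fock_End_simps:
  "S \<otimes>\<^bsub>fock_End n m\<^esub> T = compose (fock n m) S T"
  "S \<oplus>\<^bsub>fock_End n m\<^esub> T = (\<lambda>v\<in>fock n m. S v + T v)"
  "\<one>\<^bsub>fock_End n m\<^esub> = (\<lambda>v\<in>fock n m. v)"
  "\<zero>\<^bsub>fock_End n m\<^esub> = (\<lambda>v\<in>fock n m. 0)"
  by (simp_all add: fock_End_def)

lemma fock_End_uminus_carrier:
  assumes "T \<in> carrier (fock_End n m)"
  shows "(\<lambda>v\<in>fock n m. fvscale (- 1) (T v)) \<in> carrier (fock_End n m)"
proof (rule fock_EndI)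
  fix v w assume v: "v \<in> fock n m" and w: "w \<in> fock n m"
  show "(\<lambda>v\<in>fock n m. fvscale (- 1) (T v)) (v + w) =
    (\<lambda>v\<in>fock n m. fvscale (- 1) (T v)) v + (\<lambda>v\<in>fock n m. fvscale (- 1) (T v)) w"
    by (simp add: v w fock_add fock_EndD(3)[OF assms v w]) (simp add: fvscale_def fun_eq_iff)
next
  fix c v assume v: "v \<in> fock n m"
  show "(\<lambda>v\<in>fock n m. fvscale (- 1) (T v)) (fvscale c v) =
    fvscale c ((\<lambda>v\<in>fock n m. fvscale (- 1) (T v)) v)"
    by (simp add: fvscale_closed v fock_EndD(4)[OF assms v]) (simp add: fvscale_def mult.left_commute)
qed (simp_all add: fvscale_closed fock_EndD(2)[OF assms])

lemma ring_fock_End: "ring (fock_End n m)"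
proof (rule ringI)
  let ?E = "fock_End n m"
  show "abelian_group ?E"
  proof (rule abelian_groupI)
    fix S T assume S: "S \<in> carrier ?E" and T: "T \<in> carrier ?E"
    show "S \<oplus>\<^bsub>?E\<^esub> T \<in> carrier ?E"
    proof (rule fock_EndI)
      fix v w assume v: "v \<in> fock n m" and w: "w \<in> fock n m"
      show "(S \<oplus>\<^bsub>?E\<^esub> T) (v + w) = (S \<oplus>\<^bsub>?E\<^esub> T) v + (S \<oplus>\<^bsub>?E\<^esub> T) w"
        using fock_EndD(3)[OF S v w] fock_EndD(3)[OF T v w] v w
        by (simp add: fock_End_simps fock_add algebra_simps)
    next
      fix c v assume v: "v \<in> fock n m"
      show "(S \<oplus>\<^bsub>?E\<^esub> T) (fvscale c v) = fvscale c ((S \<oplus>\<^bsub>?E\<^esub> T) v)"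
        by (simp add: fock_End_simps fvscale_closed v fock_EndD(4)[OF S v] fock_EndD(4)[OF T v])
          (simp add: fvscale_def fun_eq_iff distrib_left)
    qed (simp_all add: fock_End_simps fock_add fock_EndD(2)[OF S] fock_EndD(2)[OF T])
    show "S \<oplus>\<^bsub>?E\<^esub> T = T \<oplus>\<^bsub>?E\<^esub> S"
      by (simp add: fock_End_simps add.commute)
  next
    show "\<zero>\<^bsub>?E\<^esub> \<in> carrier ?E"
      by (rule fock_EndI) (auto simp: fock_End_simps fock_zero fock_add fvscale_closed, auto simp: fvscale_def)
  next
    fix S T U assume "S \<in> carrier ?E" "T \<in> carrier ?E" "U \<in> carrier ?E"
    show "(S \<oplus>\<^bsub>?E\<^esub> T) \<oplus>\<^bsub>?E\<^esub> U = S \<oplus>\<^bsub>?E\<^esub> (T \<oplus>\<^bsub>?E\<^esub> U)"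
      by (auto simp: fock_End_simps fun_eq_iff restrict_def add.assoc)
  next
    fix S assume S: "S \<in> carrier ?E"
    show "\<zero>\<^bsub>?E\<^esub> \<oplus>\<^bsub>?E\<^esub> S = S"
      using fock_EndD(1)[OF S] by (auto simp: fock_End_simps fun_eq_iff extensional_def restrict_def)
    have "(\<lambda>v\<in>fock n m. fvscale (- 1) (S v)) \<oplus>\<^bsub>?E\<^esub> S = \<zero>\<^bsub>?E\<^esub>"
      by (auto simp: fock_End_simps fun_eq_iff restrict_def fvscale_def)
    then show "\<exists>T\<in>carrier ?E. T \<oplus>\<^bsub>?E\<^esub> S = \<zero>\<^bsub>?E\<^esub>"
      using fock_End_uminus_carrier[OF S] by blast
  qed
  show "Group.monoid ?E"
  proof (rule monoidI)
    fix S T assume S: "S \<in> carrier ?E" and T: "T \<in> carrier ?E"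
    show "S \<otimes>\<^bsub>?E\<^esub> T \<in> carrier ?E"
      using fock_EndD[OF S] fock_EndD[OF T]
      by (intro fock_EndI) (auto simp: fock_End_simps compose_def fock_add fvscale_closed)
  next
    show "\<one>\<^bsub>?E\<^esub> \<in> carrier ?E"
      by (rule fock_EndI) (auto simp: fock_End_simps fock_add fvscale_closed)
  next
    fix S T U assume S: "S \<in> carrier ?E" and T: "T \<in> carrier ?E" and U: "U \<in> carrier ?E"
    show "(S \<otimes>\<^bsub>?E\<^esub> T) \<otimes>\<^bsub>?E\<^esub> U = S \<otimes>\<^bsub>?E\<^esub> (T \<otimes>\<^bsub>?E\<^esub> U)"
      using fock_EndD(2)[OF U] by (auto simp: fock_End_simps compose_def fun_eq_iff restrict_def)
  next
    fix S assume S: "S \<in> carrier ?E"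
    show "\<one>\<^bsub>?E\<^esub> \<otimes>\<^bsub>?E\<^esub> S = S" "S \<otimes>\<^bsub>?E\<^esub> \<one>\<^bsub>?E\<^esub> = S"
      using fock_EndD(1,2)[OF S]
      by (auto simp: fock_End_simps compose_def fun_eq_iff restrict_def extensional_def)
  qed
  fix S T U assume S: "S \<in> carrier ?E" and T: "T \<in> carrier ?E" and U: "U \<in> carrier ?E"
  show "(S \<oplus>\<^bsub>?E\<^esub> T) \<otimes>\<^bsub>?E\<^esub> U = S \<otimes>\<^bsub>?E\<^esub> U \<oplus>\<^bsub>?E\<^esub> T \<otimes>\<^bsub>?E\<^esub> U"
    using fock_EndD(2)[OF U] by (auto simp: fock_End_simps compose_def fun_eq_iff restrict_def)
  show "U \<otimes>\<^bsub>?E\<^esub> (S \<oplus>\<^bsub>?E\<^esub> T) = U \<otimes>\<^bsub>?E\<^esub> S \<oplus>\<^bsub>?E\<^esub> U \<otimes>\<^bsub>?E\<^esub> T"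
    using fock_EndD(2)[OF S] fock_EndD(2)[OF T] fock_EndD(3)[OF U]
    by (auto simp: fock_End_simps compose_def fun_eq_iff restrict_def)
qed

lemma fock_End_uminus:
  assumes "T \<in> carrier (fock_End n m)"
  shows "\<ominus>\<^bsub>fock_End n m\<^esub> T = (\<lambda>v\<in>fock n m. - T v)"
proof -
  interpret ring "fock_End n m" by (rule ring_fock_End)
  have eq: "(\<lambda>v\<in>fock n m. fvscale (- 1) (T v)) = (\<lambda>v\<in>fock n m. - T v)"
    by (auto simp: fvscale_def fun_eq_iff restrict_def)
  have "(\<lambda>v\<in>fock n m. - T v) \<oplus>\<^bsub>fock_End n m\<^esub> T = \<zero>\<^bsub>fock_End n m\<^esub>"
    by (auto simp: fock_End_simps fun_eq_iff restrict_def)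
  then show ?thesis
    using minus_equality assms fock_End_uminus_carrier[OF assms] unfolding eq by blast
qed


subsection \<open>The relations of \<open>W(n|m)\<close> hold on the Fock space\<close>

lemma fock_lin_coord:
  assumes "T = (\<lambda>v\<in>fock n m. \<lambda>l. if l \<in> S then \<phi> l * v (g l) else 0)"
    and "S \<subseteq> occ n m" and "inj_on g S"
  shows "T \<in> carrier (fock_End n m)"
proof (rule fock_EndI)
  fix v assume v: "v \<in> fock n m"
  show "T v \<in> fock n m"
    using fock_reindex[OF v assms(2,3)] v by (simp add: assms(1))
  fix c
  show "T (fvscale c v) = fvscale c (T v)"
    using v fvscale_closed[OF v, of c] by (simp add: assms(1) fun_eq_iff) (simp add: fvscale_def)
next
  fix v w assume v: "v \<in> fock n m" and w: "w \<in> fock n m"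
  show "T (v + w) = T v + T w"
    using v w fock_add[OF v w] by (simp add: assms(1) fun_eq_iff distrib_left)
qed (simp add: assms(1))

lemma cplus_carrier: "cplus n m i \<in> carrier (fock_End n m)"
proof (rule fock_lin_coord)
  show "cplus n m i = (\<lambda>v\<in>fock n m. \<lambda>l. if l \<in> {l \<in> occ n m. 0 < l i}
      then csign n i l * v (l(i := l i - 1)) else 0)"
    by (simp add: cplus_def)
  show "inj_on (\<lambda>l. l(i := l i - 1)) {l \<in> occ n m. 0 < l i}"
  proof (rule inj_onI)
    fix l l' :: "nat \<Rightarrow> nat"
    assume "l \<in> {l \<in> occ n m. 0 < l i}" "l' \<in> {l \<in> occ n m. 0 < l i}"
      and eq: "l(i := l i - 1) = l'(i := l' i - 1)"
    then have pos: "0 < l i" "0 < l' i" by auto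
    have "l k = l' k" for k
      using fun_cong[OF eq, of k] pos by (cases "k = i") auto
    then show "l = l'" by (rule ext)
  qed
qed auto

lemma cminus_carrier: "cminus n m i \<in> carrier (fock_End n m)"
proof (rule fock_lin_coord)
  show "cminus n m i = (\<lambda>v\<in>fock n m. \<lambda>l. if l \<in> occ n m
      then (csign n i l * of_nat (l i + 1)) * v (l(i := l i + 1)) else 0)"
    by (simp add: cminus_def)
  show "inj_on (\<lambda>l. l(i := l i + 1)) (occ n m)"
  proof (rule inj_onI)
    fix l l' :: "nat \<Rightarrow> nat" assume eq: "l(i := l i + 1) = l'(i := l' i + 1)"
    have "l k = l' k" for k
      using fun_cong[OF eq, of k] by (cases "k = i") auto
    then show "l = l'" by (rule ext)
  qed
qed auto

lemma diag_carrier: "diag n m \<phi> \<in> carrier (fock_End n m)"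
proof (rule fock_lin_coord)
  show "diag n m \<phi> = (\<lambda>v\<in>fock n m. \<lambda>l. if l \<in> occ n m then \<phi> l * v l else 0)"
    by (auto simp: diag_def fock_def fun_eq_iff restrict_def)
qed auto

lemma scomm_fock_End:
  assumes S: "S \<in> carrier (fock_End n m)" and T: "T \<in> carrier (fock_End n m)"
  shows "scomm (fock_End n m) d d' S T = (\<lambda>v\<in>fock n m. S (T v) - fvscale ((- 1) ^ (d * d')) (T (S v)))"
proof -
  let ?E = "fock_End n m"
  interpret ring ?E by (rule ring_fock_End)
  have TS: "T \<otimes>\<^bsub>?E\<^esub> S \<in> carrier ?E" "\<ominus>\<^bsub>?E\<^esub> (T \<otimes>\<^bsub>?E\<^esub> S) \<in> carrier ?E" using S T by auto
  show ?thesis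
  proof (cases "even (d * d')")
    case True
    then show ?thesis
      by (auto simp: scomm_def rsign_def a_minus_def fock_End_uminus[OF TS(1)])
        (auto simp: fock_End_simps compose_def fun_eq_iff restrict_def fvscale_def)
  next
    case False
    then show ?thesis using TS
      by (auto simp: scomm_def rsign_def a_minus_def minus_minus)
        (auto simp: fock_End_simps compose_def fun_eq_iff restrict_def fvscale_def)
  qed
qed

lemma csign_upd:
  "csign n i (l(j := x)) = csign n i l * (- 1) ^ (if 1 \<le> j \<and> j < i then \<theta> n i * \<theta> n j * (x + l j) else 0)"
proof (cases "1 \<le> j \<and> j < i")
  case True
  let ?A = "{1..<i} - {j}"
  have A: "{1..<i} = insert j ?A" using True by auto
  have "(\<Sum>k\<in>{1..<i}. \<theta> n k * (l(j := x)) k) = \<theta> n j * x + (\<Sum>k\<in>?A. \<theta> n k * l k)"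
    by (subst A, subst sum.insert) auto
  moreover have "(\<Sum>k\<in>{1..<i}. \<theta> n k * l k) = \<theta> n j * l j + (\<Sum>k\<in>?A. \<theta> n k * l k)"
    by (subst A, subst sum.insert) auto
  ultimately have sums: "csign n i (l(j := x)) = (- 1) ^ (\<theta> n i * (\<theta> n j * x + (\<Sum>k\<in>?A. \<theta> n k * l k)))"
    "csign n i l = (- 1) ^ (\<theta> n i * (\<theta> n j * l j + (\<Sum>k\<in>?A. \<theta> n k * l k)))"
    by (simp_all add: csign_def)
  have "(- 1 :: complex fps) ^ (a * (b * x + c)) = (- 1) ^ (a * (b * y + c)) * (- 1) ^ (a * b * (x + y))" for a b c x y :: nat
  proof -
    have "(- 1 :: complex fps) ^ (a * (b * y + c)) * (- 1) ^ (a * b * (x + y))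
      = (- 1) ^ (2 * (a * b * y)) * (- 1) ^ (a * (b * x + c))"
      by (simp only: power_add[symmetric]) (simp add: algebra_simps flip: mult_2)
    then show ?thesis by simp
  qed
  from this[of "\<theta> n i" "\<theta> n j" x _ "l j"] show ?thesis using True unfolding sums by simp
next
  case False
  then have "(\<Sum>k\<in>{1..<i}. \<theta> n k * (l(j := x)) k) = (\<Sum>k\<in>{1..<i}. \<theta> n k * l k)"
    by (intro sum.cong) auto
  then show ?thesis unfolding csign_def using False by auto
qed

lemma csign_square [simp]: "csign n i l * csign n i l = 1" "csign n i l * (csign n i l * x) = x"
  by (simp_all add: csign_def power_add[symmetric] mult.assoc[symmetric] flip: mult_2)

lemma occ_upd:
  "l \<in> occ n m \<Longrightarrow> i \<in> {1..n+m} \<Longrightarrow> l(i := x) \<in> occ n m \<longleftrightarrow> (n < i \<longrightarrow> x \<le> 1)"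
  by (auto simp: occ_def)

lemma occ_le_1: "l \<in> occ n m \<Longrightarrow> n < i \<Longrightarrow> l i \<le> 1"
  by (cases "i \<in> {n+1..n+m}") (auto simp: occ_def)

lemma W_rel_diag:
  assumes i: "i \<in> {1..n+m}"
  shows "scomm (fock_End n m) (\<theta> n i) (\<theta> n i) (cminus n m i) (cplus n m i) = \<one>\<^bsub>fock_End n m\<^esub>"
proof -
  have "(cminus n m i (cplus n m i v) - fvscale ((- 1) ^ (\<theta> n i * \<theta> n i)) (cplus n m i (cminus n m i v))) l = v l"
    if v: "v \<in> fock n m" for v l
  proof (cases "l \<in> occ n m")
    case False
    then have "v l = 0" using v by (simp add: fock_def)
    then show ?thesis using v False fock_EndD(2)[OF cplus_carrier v, of i] fock_EndD(2)[OF cminus_carrier v, of i]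
      by (auto simp: cplus_def cminus_def fvscale_def)
  next
    case True
    show ?thesis using True v fock_EndD(2)[OF cplus_carrier v, of i] fock_EndD(2)[OF cminus_carrier v, of i]
        occ_le_1[OF True, of i]
      by (auto simp: cplus_def cminus_def fvscale_def csign_upd occ_upd[OF True i] \<theta>_def
          algebra_simps le_Suc_eq fun_upd_idem)
  qed
  then show ?thesis
    unfolding scomm_fock_End[OF cminus_carrier cplus_carrier] fock_End_simps
    by (intro restrict_ext ext)
qed

lemma W_rel_mixed:
  assumes i: "i \<in> {1..n+m}" and j: "j \<in> {1..n+m}" and ij: "i \<noteq> j"
  shows "scomm (fock_End n m) (\<theta> n i) (\<theta> n j) (cminus n m i) (cplus n m j) = \<zero>\<^bsub>fock_End n m\<^esub>"
proof -
  have "(cminus n m i (cplus n m j v) - fvscale ((- 1) ^ (\<theta> n i * \<theta> n j)) (cplus n m j (cminus n m i v))) l = 0"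
    if v: "v \<in> fock n m" for v l
    using v fock_EndD(2)[OF cplus_carrier v, of j] fock_EndD(2)[OF cminus_carrier v, of i]
      occ_le_1[of l n m i] occ_le_1[of l n m j] ij ij[symmetric] i j
      fun_upd_twist[OF ij, of l "l i + 1" "l j - 1"]
      fock_zero_off[OF v, of "l(i := l i + 1, j := l j - 1)"]
    by (cases "l \<in> occ n m"; cases i j rule: linorder_cases)
       (auto simp: cplus_def cminus_def fvscale_def csign_upd occ_upd \<theta>_def
          algebra_simps le_Suc_eq)
  then show ?thesis
    unfolding scomm_fock_End[OF cminus_carrier cplus_carrier] fock_End_simps
    by (intro restrict_ext ext) auto
qed

lemma W_rel_plus:
  assumes i: "i \<in> {1..n+m}" and j: "j \<in> {1..n+m}"
  shows "scomm (fock_End n m) (\<theta> n i) (\<theta> n j) (cplus n m i) (cplus n m j) = \<zero>\<^bsub>fock_End n m\<^esub>"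
proof -
  have "(cplus n m i (cplus n m j v) - fvscale ((- 1) ^ (\<theta> n i * \<theta> n j)) (cplus n m j (cplus n m i v))) l = 0"
    if v: "v \<in> fock n m" for v l
    using v fock_EndD(2)[OF cplus_carrier v, of j] fock_EndD(2)[OF cplus_carrier v, of i]
      occ_le_1[of l n m i] occ_le_1[of l n m j] i j
      fun_upd_twist[of i j l "l i - 1" "l j - 1"]
    by (cases "l \<in> occ n m"; cases i j rule: linorder_cases)
       (auto simp: cplus_def cminus_def fvscale_def csign_upd occ_upd \<theta>_def
          algebra_simps le_Suc_eq)
  then show ?thesis
    unfolding scomm_fock_End[OF cplus_carrier cplus_carrier] fock_End_simps
    by (intro restrict_ext ext) auto
qed

lemma W_rel_minus:
  assumes i: "i \<in> {1..n+m}" and j: "j \<in> {1..n+m}"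
  shows "scomm (fock_End n m) (\<theta> n i) (\<theta> n j) (cminus n m i) (cminus n m j) = \<zero>\<^bsub>fock_End n m\<^esub>"
proof -
  have "(cminus n m i (cminus n m j v) - fvscale ((- 1) ^ (\<theta> n i * \<theta> n j)) (cminus n m j (cminus n m i v))) l = 0"
    if v: "v \<in> fock n m" for v l
  proof -
    have z: "i \<noteq> j \<Longrightarrow> n < j \<and> 1 \<le> l j \<or> n < i \<and> 1 \<le> l i \<Longrightarrow> v (l(i := l i + 1, j := l j + 1)) = 0"
      using fock_zero_off[OF v, of "l(i := l i + 1, j := l j + 1)"]
        occ_le_1[of "l(i := l i + 1, j := l j + 1)" n m j]
        occ_le_1[of "l(i := l i + 1, j := l j + 1)" n m i] by fastforce
    show ?thesis
    using v fock_EndD(2)[OF cminus_carrier v, of j] fock_EndD(2)[OF cminus_carrier v, of i]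
      occ_le_1[of l n m i] occ_le_1[of l n m j] i j
      fun_upd_twist[of i j l "l i + 1" "l j + 1"] z
      fock_zero_off[OF v, of "l(i := l i + 2)"]
    by (cases "l \<in> occ n m"; cases i j rule: linorder_cases)
       (auto simp: cplus_def cminus_def fvscale_def csign_upd occ_upd \<theta>_def
          algebra_simps le_Suc_eq)
  qed
  then show ?thesis
    unfolding scomm_fock_End[OF cminus_carrier cminus_carrier] fock_End_simps
    by (intro restrict_ext ext) auto
qed

lemma number_operator:
  assumes i: "i \<in> {1..n+m}"
  shows "cplus n m i \<otimes>\<^bsub>fock_End n m\<^esub> cminus n m i = diag n m (\<lambda>l. of_nat (l i))"
proof -
  have "cplus n m i (cminus n m i v) l = of_nat (l i) * v l" if v: "v \<in> fock n m" for v l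
    using v fock_EndD(2)[OF cminus_carrier v, of i] fock_zero_off[OF v, of l]
      occ_le_1[of l n m i] i
    by (cases "l \<in> occ n m")
       (auto simp: cplus_def cminus_def csign_upd occ_upd algebra_simps le_Suc_eq)
  then show ?thesis
    by (auto simp: fock_End_simps compose_def diag_def fun_eq_iff restrict_def)
qed

lemma ket_fock: "l \<in> occ n m \<Longrightarrow> ket l \<in> fock n m"
proof -
  assume l: "l \<in> occ n m"
  have "{l'. fps_nth (ket l l') k \<noteq> 0} \<subseteq> {l}" for k by (auto simp: ket_def)
  then have "finite {l'. fps_nth (ket l l') k \<noteq> 0}" for k by (rule finite_subset) simp
  then show ?thesis using l by (auto simp: fock_def ket_def)
qed

lemma vacuum: "cminus n m i (ket (\<lambda>_. 0)) = 0"
proof -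
  have "(\<lambda>_. 0) \<in> occ n m" by (simp add: occ_def)
  moreover have "l(i := l i + 1) \<noteq> (\<lambda>_. 0)" for l :: "nat \<Rightarrow> nat"
  proof
    assume "l(i := l i + 1) = (\<lambda>_. 0)"
    from fun_cong[OF this, of i] show False by simp
  qed
  ultimately have "cminus n m i (ket (\<lambda>_. 0)) l = 0 l" for l
    using ket_fock[of "\<lambda>_. 0" n m] by (simp add: cminus_def) (simp add: ket_def)
  then show ?thesis by (rule ext)
qed

lemma cplus_ket:
  assumes "l \<in> occ n m" "l(i := Suc (l i)) \<in> occ n m" "\<And>k. k < i \<Longrightarrow> l k = 0"
  shows "cplus n m i (ket l) = ket (l(i := Suc (l i)))"
proof
  fix l'
  have sgn: "csign n i (l(i := Suc (l i))) = 1"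
    using assms(3) by (simp add: csign_def)
  have "l' (i := l' i - 1) = l \<and> 0 < l' i \<longleftrightarrow> l' = l(i := Suc (l i))"
  proof
    assume a: "l' (i := l' i - 1) = l \<and> 0 < l' i"
    then have "l i = l' i - 1" by auto
    with a have "l(i := Suc (l i)) = (l' (i := l' i - 1))(i := l' i)" by simp
    then show "l' = l(i := Suc (l i))" by simp
  qed simp
  then show "cplus n m i (ket l) l' = ket (l(i := Suc (l i))) l'"
    using ket_fock[OF assms(1)] assms(2) sgn by (auto simp: cplus_def ket_def)
qed

lemma cplus_power_ket:
  assumes i: "i \<in> {1..n+m}" and "l \<in> occ n m" "l(i := a) \<in> occ n m" "\<And>k. k \<le> i \<Longrightarrow> l k = 0"
  shows "(cplus n m i ^^ a) (ket l) = ket (l(i := a))"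
  using assms(3)
proof (induction a)
  case 0
  then show ?case using assms(4) by (simp add: fun_upd_idem)
next
  case (Suc a)
  have mem: "l(i := a) \<in> occ n m" using Suc.prems unfolding occ_upd[OF assms(2) i] by simp
  show ?case
    using Suc.IH[OF mem] cplus_ket[OF mem, of i] Suc.prems assms(4) by (simp del: fun_upd_apply add: fun_upd_same fun_upd_other)
qed

lemma basis_monomial:
  assumes l: "l \<in> occ n m"
  shows "foldr (\<lambda>i v. (cplus n m i ^^ l i) v) [1..<Suc (n+m)] (ket (\<lambda>_. 0)) = ket l"
proof -
  have sub: "(\<lambda>i. if k \<le> i then l i else 0) \<in> occ n m" for k
    using l by (auto simp: occ_def)
  have "foldr (\<lambda>i v. (cplus n m i ^^ l i) v) [k..<Suc (n+m)] (ket (\<lambda>_. 0))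
      = ket (\<lambda>i. if k \<le> i then l i else 0)" if "1 \<le> k" "k \<le> Suc (n+m)" for k
    using that(2,1)
  proof (induction rule: inc_induct)
    case base
    have "(\<lambda>i. if Suc (n+m) \<le> i then l i else 0) = (\<lambda>_. 0)"
      using l by (auto simp: occ_def fun_eq_iff)
    then show ?case by simp
  next
    case (step k)
    have upd: "(\<lambda>i. if Suc k \<le> i then l i else 0)(k := l k) = (\<lambda>i. if k \<le> i then l i else 0)"
      by (auto simp: fun_eq_iff)
    have "(cplus n m k ^^ l k) (ket (\<lambda>i. if Suc k \<le> i then l i else 0))
        = ket (\<lambda>i. if k \<le> i then l i else 0)"
      using cplus_power_ket[of k n m "\<lambda>i. if Suc k \<le> i then l i else 0" "l k"] sub[of k] sub[of "Suc k"]
        step.prems step.hyps unfolding upd by simp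
    then show ?case using step by (simp add: upt_conv_Cons del: upt_Suc)
  qed
  from this[of 1] have "foldr (\<lambda>i v. (cplus n m i ^^ l i) v) [1..<Suc (n+m)] (ket (\<lambda>_. 0))
      = ket (\<lambda>i. if 1 \<le> i then l i else 0)"
    by linarith
  moreover have "(\<lambda>i. if 1 \<le> i then l i else 0) = l"
    using l by (auto simp: occ_def fun_eq_iff)
  ultimately show ?thesis by (rule trans[OF _ arg_cong])
qed

end

theory Submission
  imports Defs
begin

text \<open>Moving the diagonal factors to the left turns the supercommutator of \<open>\<rho>(a\<^sub>i\<^sup>-)\<close> and
  \<open>\<rho>(a\<^sub>j\<^sup>+)\<close>, \<open>i \<noteq> j\<close>, into a diagonal operator times \<open>c\<^sub>j\<^sup>+ c\<^sub>i\<^sup>-\<close>, in which the dependence on \<open>p\<close>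
  is a power of \<open>q\<close>. The Cartan-Weyl element is then found by cancelling \<open>\<rho>(L\<^sub>i)\<close> or \<open>\<rho>(L\<^sub>j\<^sup>-\<^sup>1)\<close>,
  which are diagonal and invertible.\<close>

text \<open>The choice of the roots \<open>s\<close> drops out because both orders of the product
  pair equal arguments: raising l_i and then reading \<open>s\<close> at N - 1 gives
  \<open>s\<close> at N, and lowering l_j turns N into N - 1. This leaves values [p-N] and [p-N+1],
  whose plain difference is in general no single power of q. The prefactors q^(N_1+...+N_(i-1))
  repair this: since c_j^+ c_i^- changes these partial sums, exactly one of the two terms receives
  an extra q^-1. Which one depends on the order of i and j, hence the two cases. Two obstacles shape
  the rest. L_i is the class of an infinite series, whereas a representation is only a ring
  homomorphism with prescribed scalars, so its value on L_i has to be derived. And coefficients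
  involving the truncated l_j - 1 are wrong at l_j = 0; they are compared only where 0 < l_j, which
  suffices because c_j^+ stands to the left of c_i^-.\<close>

section \<open>Powers of q and two-term identities for q-numbers\<close>

lemma qpow_add: "qpow (x + y) = qpow x * qpow y"
  by (simp add: qpow_def fps_exp_add_mult)

lemma qpow_0 [simp]: "qpow 0 = 1"
  by (simp add: qpow_def)

lemma qpow_uminus_mult [simp]: "qpow (- x) * qpow x = 1" "qpow x * qpow (- x) = 1"
  by (simp_all flip: qpow_add)

lemma qden_nonzero: "qpow 1 - qpow (- 1) \<noteq> 0"
  using qden(2) by (metis fps_shift_zero fps_zero_nth zero_neq_numeral)

text \<open>After multiplication by q - q^-1 the two terms q^(-x-1) cancel and q^(x-1) - q^(x+1)
  remains.\<close>

lemma qnum_down: "qpow (- 1) * qnum x - qnum (x + 1) = - qpow x"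
proof -
  let ?d = "qpow 1 - qpow (- 1)"
  have "(qpow (- 1) * qnum x - qnum (x + 1)) * ?d
      = qpow (- 1) * (qnum x * ?d) - qnum (x + 1) * ?d"
    by (simp only: left_diff_distrib mult.assoc)
  also have "\<dots> = - qpow x * ?d"
    unfolding qnum_mult by (simp add: algebra_simps flip: qpow_add)
  finally show ?thesis using qden_nonzero by (simp only: mult_cancel_right) simp
qed

text \<open>This is \<open>qnum_down\<close> with q replaced by q^-1, multiplied by q^-1; now the
  two terms q^x cancel.\<close>

lemma qnum_up: "qnum x - qpow (- 1) * qnum (x + 1) = - qpow (- x - 1)"
proof -
  let ?d = "qpow 1 - qpow (- 1)"
  have "(qnum x - qpow (- 1) * qnum (x + 1)) * ?d
      = qnum x * ?d - qpow (- 1) * (qnum (x + 1) * ?d)"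
    by (simp only: left_diff_distrib mult.assoc)
  also have "qpow (- 1) * (qnum (x + 1) * ?d) = qpow x - qpow (- x - 1) * qpow (- 1)"
  proof -
    have "qpow (- 1) * qpow (x + 1) = qpow x" unfolding qpow_add[symmetric] by simp
    moreover have "- (x + 1) = - x - 1" by simp
    ultimately show ?thesis unfolding qnum_mult by (simp only: right_diff_distrib mult.commute)
  qed
  also have "qnum x * ?d - \<dots> = - qpow (- x - 1) * ?d"
  proof -
    have "qpow (- x - 1) * qpow 1 = qpow (- x)" unfolding qpow_add[symmetric] by simp
    then show ?thesis unfolding qnum_mult by (simp add: right_diff_distrib)
  qed
  finally show ?thesis using qden_nonzero by (simp only: mult_cancel_right) simp
qed


section \<open>The \<open>h\<close>-adic exponential under a representation\<close>

lemma ucls_ring_hom: "ucls n m \<in> ring_hom (free_alg (n+m)) (Uq n m)"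
proof -
  have "ucls n m = (+>\<^bsub>free_alg (n+m)\<^esub>) (uq_ideal n m)"
    by (simp add: ucls_def fun_eq_iff)
  then show ?thesis
    unfolding Uq_def using ideal.rcos_ring_hom[OF uq_ideal, of n m] by simp
qed

lemma funit_carrier: "funit \<in> carrier (free_alg r)"
  using ring.ring_simprules(6)[OF ring_free_alg] by (simp add: free_alg_simps)

lemma fpow_carrier: "x \<in> carrier (free_alg r) \<Longrightarrow> fpow x k \<in> carrier (free_alg r)"
  by (induction k) (auto simp: fpow_def funit_carrier fmul_carrier)

lemma fsum_carrier:
  "(\<And>k. k \<in> A \<Longrightarrow> f k \<in> carrier (free_alg r)) \<Longrightarrow> sum f A \<in> carrier (free_alg r)"
proof (induction A rule: infinite_finite_induct)
  case (insert a A)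
  then have "f a + sum f A \<in> carrier (free_alg r)" by (intro fadd_carrier) blast+
  then show ?case using insert.hyps by (simp only: sum.insert not_False_eq_True)
qed (simp_all add: free_alg_carrier)

lemma diag_mult: "diag n m \<phi> \<otimes>\<^bsub>fock_End n m\<^esub> diag n m \<psi> = diag n m (\<lambda>l. \<phi> l * \<psi> l)"
  by (auto simp: fock_End_simps compose_def diag_def fun_eq_iff restrict_def fock_diag mult.assoc)

lemma diag_add: "diag n m \<phi> \<oplus>\<^bsub>fock_End n m\<^esub> diag n m \<psi> = diag n m (\<lambda>l. \<phi> l + \<psi> l)"
  by (auto simp: fock_End_simps diag_def fun_eq_iff restrict_def distrib_right)

lemma diag_one: "diag n m (\<lambda>_. 1) = \<one>\<^bsub>fock_End n m\<^esub>"
  by (auto simp: fock_End_simps diag_def fun_eq_iff restrict_def)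

lemma diag_zero: "diag n m (\<lambda>_. 0) = \<zero>\<^bsub>fock_End n m\<^esub>"
  by (auto simp: fock_End_simps diag_def fun_eq_iff restrict_def)

section \<open>Truncating q^x modulo powers of h\<close>

text \<open>Coefficient k of the quotient is coefficient k + K of \<open>y\<close>, so only finitely
  many words occur at each order. The quotient therefore lies in the completed algebra again and a
  representation can be applied to it.\<close>

lemma free_alg_divide_X_power:
  assumes y: "y \<in> carrier (free_alg r)" and low: "\<And>w j. j < K \<Longrightarrow> fps_nth (y w) j = 0"
  obtains z where "z \<in> carrier (free_alg r)" "y = fscale (fps_X ^ K) z"
proof
  let ?z = "\<lambda>w. fps_shift K (y w)"
  show "?z \<in> carrier (free_alg r)"
  proof -
    have "y w \<noteq> 0" if "?z w \<noteq> 0" for w using that by auto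
    moreover have "finite {w. fps_nth (?z w) k \<noteq> 0}" for k
      using y by (simp add: free_alg_carrier)
    ultimately show ?thesis using y unfolding free_alg_carrier by blast
  qed
  show "y = fscale (fps_X ^ K) ?z"
    using low by (auto simp: fscale_def fun_eq_iff fps_eq_iff fps_X_power_mult_nth)
qed

text \<open>\<open>fqpow\<close> is collected coefficient by coefficient, a form that a ring
  homomorphism cannot see. A finite sum plus an exact multiple of h^K is a form that it can.\<close>

lemma fqpow_truncate:
  assumes x: "x \<in> carrier (free_alg r)"
  obtains z where "z \<in> carrier (free_alg r)"
    "fqpow x = (\<Sum>k<K. fscale (fps_const (1 / fact k) * fps_X ^ k) (fpow x k)) + fscale (fps_X ^ K) z"
proof -
  let ?E = "\<Sum>k<K. fscale (fps_const (1 / fact k) * fps_X ^ k) (fpow x k)"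
  have "?E \<in> carrier (free_alg r)"
    by (intro fsum_carrier fscale_carrier fpow_carrier x)
  then have carr: "fqpow x - ?E \<in> carrier (free_alg r)"
    by (intro fdiff_carrier fqpow_carrier x)
  have low: "fps_nth ((fqpow x - ?E) w) j = 0" if j: "j < K" for w j
  proof -
    have ap: "(\<Sum>k\<in>A. f k) w = (\<Sum>k\<in>A. f k w)" for f :: "nat \<Rightarrow> fel" and A
      by (induction A rule: infinite_finite_induct) auto
    have "fps_nth (?E w) j = (\<Sum>k<K. if j < k then 0 else fps_nth (fpow x k w) (j - k) / fact k)"
      by (simp add: ap fps_sum_nth fscale_def mult.assoc fps_X_power_mult_nth if_distrib cong: if_cong)
    \<comment> \<open>The terms with j < k carry the factor h^k and contribute nothing to order
      j.\<close>
    also have "\<dots> = (\<Sum>k\<le>j. fps_nth (fpow x k w) (j - k) / fact k)"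
      using j by (intro sum.mono_neutral_cong_right) auto
    finally show ?thesis by (simp add: fqpow_def)
  qed
  from free_alg_divide_X_power[OF carr low] obtain z
    where z: "z \<in> carrier (free_alg r)" "fqpow x - ?E = fscale (fps_X ^ K) z" by blast
  then have "fqpow x = ?E + fscale (fps_X ^ K) z" by (simp add: algebra_simps)
  with z(1) show thesis by (rule that)
qed

lemma fps_nth_mult_cong:
  "(\<And>i. i \<le> j \<Longrightarrow> fps_nth a i = fps_nth b i) \<Longrightarrow> fps_nth (a * c) j = fps_nth (b * c) j"
  by (simp add: fps_mult_nth)

section \<open>Values of an arbitrary representation on words\<close>

context
  fixes n m \<rho>
  assumes rep: "fock_rep n m \<rho>"
begin

lemma rep_ring_hom: "\<rho> \<in> ring_hom (Uq n m) (fock_End n m)"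
  using rep by (simp add: fock_rep_def)

lemma rep_closed: "u \<in> carrier (Uq n m) \<Longrightarrow> \<rho> u \<in> carrier (fock_End n m)"
  by (rule ring_hom_closed[OF rep_ring_hom])

lemma word_hom: "\<rho> \<circ> ucls n m \<in> ring_hom (free_alg (n+m)) (fock_End n m)"
  by (rule ring_hom_trans[OF ucls_ring_hom rep_ring_hom])

lemma word_closed: "x \<in> carrier (free_alg (n+m)) \<Longrightarrow> \<rho> (ucls n m x) \<in> carrier (fock_End n m)"
  using ring_hom_closed[OF word_hom] by simp

lemma word_mult:
  "x \<in> carrier (free_alg (n+m)) \<Longrightarrow> y \<in> carrier (free_alg (n+m)) \<Longrightarrow>
    \<rho> (ucls n m (x \<star> y)) = \<rho> (ucls n m x) \<otimes>\<^bsub>fock_End n m\<^esub> \<rho> (ucls n m y)"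
  using ring_hom_mult[OF word_hom] by (simp add: free_alg_simps)

lemma word_add:
  "x \<in> carrier (free_alg (n+m)) \<Longrightarrow> y \<in> carrier (free_alg (n+m)) \<Longrightarrow>
    \<rho> (ucls n m (x + y)) = \<rho> (ucls n m x) \<oplus>\<^bsub>fock_End n m\<^esub> \<rho> (ucls n m y)"
  using ring_hom_add[OF word_hom] by (simp add: free_alg_simps)

lemma word_one: "\<rho> (ucls n m funit) = diag n m (\<lambda>_. 1)"
  using ring_hom_one[OF word_hom] by (simp add: free_alg_simps diag_one)

lemma word_zero: "\<rho> (ucls n m 0) = diag n m (\<lambda>_. 0)"
  using ring_hom_zero[OF word_hom ring_free_alg ring_fock_End] by (simp add: free_alg_simps diag_zero)

text \<open>\<open>fock_rep\<close> fixes the images of multiples of the unit; linearity over power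
  series follows by writing a multiple of x as a product with such an element.\<close>

lemma word_scale:
  assumes "x \<in> carrier (free_alg (n+m))"
  shows "\<rho> (ucls n m (fscale c x)) = diag n m (\<lambda>_. c) \<otimes>\<^bsub>fock_End n m\<^esub> \<rho> (ucls n m x)"
proof -
  have "fscale c x = fscale c funit \<star> x" by (simp add: fmul_scale fmul_unit)
  moreover have "\<rho> (ucls n m (fscale c funit)) = diag n m (\<lambda>_. c)"
    using rep by (simp add: fock_rep_def uscalar_def)
  ultimately show ?thesis
    using word_mult[OF fscale_carrier[OF funit_carrier] assms] by simp
qed

lemma word_fpow_diag:
  assumes "x \<in> carrier (free_alg (n+m))" "\<rho> (ucls n m x) = diag n m \<phi>"
  shows "\<rho> (ucls n m (fpow x k)) = diag n m (\<lambda>l. \<phi> l ^ k)"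
proof (induction k)
  case 0
  then show ?case by (simp add: fpow_def word_one)
next
  case (Suc k)
  have "fpow x (Suc k) = x \<star> fpow x k" by (simp add: fpow_def)
  then show ?case
    using Suc assms by (simp add: word_mult fpow_carrier diag_mult)
qed

text \<open>A linear map sends multiples of \<open>h\<^sup>K\<close> to multiples of \<open>h\<^sup>K\<close>, so it commutes with the
  \<open>h\<close>-adically convergent series \<open>q\<^sup>x\<close> without any continuity assumption.\<close>

lemma word_fqpow_diag:
  assumes x: "x \<in> carrier (free_alg (n+m))"
    and \<phi>: "\<rho> (ucls n m x) = diag n m (\<lambda>l. fps_const (a l))"
  shows "\<rho> (ucls n m (fqpow x)) = diag n m (\<lambda>l. qpow (a l))"
proof (rule extensionalityI)
  show "\<rho> (ucls n m (fqpow x)) \<in> extensional (fock n m)"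
    by (rule fock_EndD(1)[OF word_closed[OF fqpow_carrier[OF x]]])
  show "diag n m (\<lambda>l. qpow (a l)) \<in> extensional (fock n m)"
    by (rule fock_EndD(1)[OF diag_carrier])
  fix v assume v: "v \<in> fock n m"
  show "\<rho> (ucls n m (fqpow x)) v = diag n m (\<lambda>l. qpow (a l)) v"
  proof (intro ext fps_ext)
    fix l j
    let ?f = "\<lambda>k. fscale (fps_const (1 / fact k) * fps_X ^ k) (fpow x k)"
    let ?\<psi> = "\<lambda>K l. \<Sum>k<K. fps_const (a l ^ k / fact k) * fps_X ^ k"
    have f: "?f k \<in> carrier (free_alg (n+m))" for k
      by (intro fscale_carrier fpow_carrier x)
    have E: "\<rho> (ucls n m (\<Sum>k<K. ?f k)) = diag n m (?\<psi> K)" for K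
    proof (induction K)
      case (Suc K)
      have "\<rho> (ucls n m (?f K)) = diag n m (\<lambda>l. fps_const (a l ^ K / fact K) * fps_X ^ K)"
      proof -
        have "fps_const (1 / fact K) * fps_X ^ K * fps_const (a l) ^ K = fps_const (a l ^ K / fact K) * fps_X ^ K" for l
        proof -
          have "fps_const (a l ^ K / fact K) = fps_const (1 / fact K) * fps_const (a l) ^ K" by simp
          then show ?thesis by (simp only: ac_simps)
        qed
        then show ?thesis
          by (simp only: word_scale[OF fpow_carrier[OF x]] word_fpow_diag[OF x \<phi>] diag_mult)
      qed
      then show ?case
        using word_add[OF fsum_carrier[of "{..<K}" ?f, OF f] f[of K]] Suc
        by (simp only: sum.lessThan_Suc diag_add)
    qed (simp only: lessThan_0 sum.empty word_zero)
    \<comment> \<open>Cutting at \<open>Suc j\<close> makes the image of the remainder a multiple of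
      h^(j+1), which does not reach the coefficient of h^j under comparison. The truncated
      exponential agrees with q^(a l) up to that order.\<close>
    obtain z where z: "z \<in> carrier (free_alg (n+m))"
      "fqpow x = (\<Sum>k<Suc j. ?f k) + fscale (fps_X ^ Suc j) z"
      using fqpow_truncate[OF x] by blast
    have "\<rho> (ucls n m (fqpow x)) = diag n m (?\<psi> (Suc j))
        \<oplus>\<^bsub>fock_End n m\<^esub> (diag n m (\<lambda>_. fps_X ^ Suc j) \<otimes>\<^bsub>fock_End n m\<^esub> \<rho> (ucls n m z))"
      unfolding z(2) word_add[OF fsum_carrier[of "{..<Suc j}" ?f, OF f] fscale_carrier[OF z(1)]]
        E word_scale[OF z(1)]
      by (rule refl)
    then have "\<rho> (ucls n m (fqpow x)) v l = ?\<psi> (Suc j) l * v l + fps_X ^ Suc j * \<rho> (ucls n m z) v l"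
      using v fock_EndD(2)[OF word_closed[OF z(1)] v]
      by (simp add: fock_End_simps compose_def diag_def del: power_Suc sum.lessThan_Suc)
    then have "fps_nth (\<rho> (ucls n m (fqpow x)) v l) j = fps_nth (?\<psi> (Suc j) l * v l) j"
      by (simp add: fps_X_power_mult_nth del: power_Suc sum.lessThan_Suc)
    also have "\<dots> = fps_nth (qpow (a l) * v l) j"
    proof (rule fps_nth_mult_cong)
      fix i assume "i \<le> j"
      then show "fps_nth (?\<psi> (Suc j) l) i = fps_nth (qpow (a l)) i"
        by (simp add: fps_sum_nth qpow_def sum.delta' if_distrib cong: if_cong del: sum.lessThan_Suc)
    qed
    finally show "fps_nth (\<rho> (ucls n m (fqpow x)) v l) j = fps_nth (diag n m (\<lambda>l. qpow (a l)) v l) j"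
      using v by (simp add: diag_def)
  qed
qed

lemma word_fqpow_uminus_diag:
  assumes x: "x \<in> carrier (free_alg (n+m))"
    and \<phi>: "\<rho> (ucls n m x) = diag n m (\<lambda>l. fps_const (a l))"
  shows "\<rho> (ucls n m (fqpow (- x))) = diag n m (\<lambda>l. qpow (- a l))"
proof -
  have e: "- x = fscale (- 1) x" by (simp add: fscale_def fun_eq_iff)
  show ?thesis
    by (rule word_fqpow_diag) (simp_all add: e fscale_carrier x word_scale \<phi> diag_mult)
qed

lemma rep_rsign:
  "u \<in> carrier (Uq n m) \<Longrightarrow> \<rho> (rsign (Uq n m) d u) = rsign (fock_End n m) d (\<rho> u)"
proof -
  interpret ring_hom_ring "Uq n m" "fock_End n m" \<rho>
    by (intro ring_hom_ringI2 ring_Uq ring_fock_End rep_ring_hom)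
  show "u \<in> carrier (Uq n m) \<Longrightarrow> ?thesis" by (simp add: rsign_def)
qed

text \<open>The sign is governed by the degrees passed as arguments and not by the elements, so a
  ring homomorphism carries it over unchanged.\<close>

lemma rep_scomm:
  assumes "u \<in> carrier (Uq n m)" "w \<in> carrier (Uq n m)"
  shows "\<rho> (scomm (Uq n m) d d' u w) = scomm (fock_End n m) d d' (\<rho> u) (\<rho> w)"
proof -
  interpret ring_hom_ring "Uq n m" "fock_End n m" \<rho>
    by (intro ring_hom_ringI2 ring_Uq ring_fock_End rep_ring_hom)
  have "rsign (Uq n m) (d * d') (w \<otimes>\<^bsub>Uq n m\<^esub> u) \<in> carrier (Uq n m)"
    using assms by (simp add: rsign_def)
  then show ?thesis
    using assms by (simp add: scomm_def a_minus_def rep_rsign)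
qed

end

section \<open>The commutator of the Holstein-Primakoff operators\<close>

lemma diag_mult_apply:
  assumes "T \<in> carrier (fock_End n m)" "v \<in> fock n m"
  shows "(diag n m \<phi> \<otimes>\<^bsub>fock_End n m\<^esub> T) v l = \<phi> l * T v l"
proof -
  have "T v \<in> fock n m" by (rule fock_EndD(2)[OF assms])
  then show ?thesis using assms(2) by (simp add: fock_End_simps compose_def diag_def)
qed

lemma fock_End_eqI:
  assumes "S \<in> carrier (fock_End n m)" "T \<in> carrier (fock_End n m)"
    and "\<And>v l. v \<in> fock n m \<Longrightarrow> S v l = T v l"
  shows "S = T"
proof (rule extensionalityI[OF fock_EndD(1)[OF assms(1)] fock_EndD(1)[OF assms(2)]])
  show "S v = T v" if "v \<in> fock n m" for v
    by (rule ext) (rule assms(3)[OF that])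
qed

lemma fock_End_mult_carrier:
  "S \<in> carrier (fock_End n m) \<Longrightarrow> T \<in> carrier (fock_End n m) \<Longrightarrow> S \<otimes>\<^bsub>fock_End n m\<^esub> T \<in> carrier (fock_End n m)"
  by (rule ring.ring_simprules(5)[OF ring_fock_End])

lemma fock_End_mult_apply: "v \<in> fock n m \<Longrightarrow> (S \<otimes>\<^bsub>fock_End n m\<^esub> T) v = S (T v)"
  by (simp add: fock_End_simps compose_def)

lemma diag_apply: "v \<in> fock n m \<Longrightarrow> diag n m \<phi> v l = \<phi> l * v l"
  by (simp add: diag_def)

text \<open>Coordinate \<open>l\<close> of the image under c_i^- reads the argument at l_i + 1. On
  coordinates the lowering operator thus shifts a coefficient upwards.\<close>

lemma cminus_mult_diag:
  "cminus n m i \<otimes>\<^bsub>fock_End n m\<^esub> diag n m \<phi>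
    = diag n m (\<lambda>l. \<phi> (l(i := l i + 1))) \<otimes>\<^bsub>fock_End n m\<^esub> cminus n m i"
proof -
  have "cminus n m i (diag n m \<phi> v) l = \<phi> (l(i := l i + 1)) * cminus n m i v l" if "v \<in> fock n m" for v l
    using that fock_EndD(2)[OF diag_carrier that] by (simp add: cminus_def) (simp add: diag_def)
  then show ?thesis
    by (intro fock_End_eqI[where n = n and m = m] fock_End_mult_carrier diag_carrier cminus_carrier)
      (simp add: diag_apply fock_EndD(2)[OF cminus_carrier] fock_End_mult_apply)
qed

text \<open>Dual to the lowering case. Where l_i = 0 the truncated l_i - 1 is harmless, since c_i^+
  yields 0 at that coordinate.\<close>

lemma cplus_mult_diag:
  "cplus n m i \<otimes>\<^bsub>fock_End n m\<^esub> diag n m \<phi>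
    = diag n m (\<lambda>l. \<phi> (l(i := l i - 1))) \<otimes>\<^bsub>fock_End n m\<^esub> cplus n m i"
proof -
  have "cplus n m i (diag n m \<phi> v) l = \<phi> (l(i := l i - 1)) * cplus n m i v l" if "v \<in> fock n m" for v l
    using that fock_EndD(2)[OF diag_carrier that] by (simp add: cplus_def) (simp add: diag_def)
  then show ?thesis
    by (intro fock_End_eqI[where n = n and m = m] fock_End_mult_carrier diag_carrier cplus_carrier)
      (simp add: diag_apply fock_EndD(2)[OF cplus_carrier] fock_End_mult_apply)
qed

text \<open>Nothing in the image of c_j^+ has a coordinate with l_j = 0, so diagonal coefficients in
  front of it may be changed there freely.\<close>

lemma diag_cplus_cong:
  assumes T: "T \<in> carrier (fock_End n m)"
    and eq: "\<And>l. 0 < l j \<Longrightarrow> \<phi> l = \<psi> l"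
  shows "diag n m \<phi> \<otimes>\<^bsub>fock_End n m\<^esub> (cplus n m j \<otimes>\<^bsub>fock_End n m\<^esub> T)
    = diag n m \<psi> \<otimes>\<^bsub>fock_End n m\<^esub> (cplus n m j \<otimes>\<^bsub>fock_End n m\<^esub> T)"
proof -
  have "\<phi> l * cplus n m j w l = \<psi> l * cplus n m j w l" if "w \<in> fock n m" for w l
    using that eq[of l] by (simp add: cplus_def)
  then show ?thesis
    using fock_EndD(2)[OF T]
    by (intro fock_End_eqI[where n = n and m = m] fock_End_mult_carrier diag_carrier cplus_carrier T)
      (simp add: diag_apply fock_EndD(2)[OF cplus_carrier] fock_End_mult_apply)
qed

lemma cminus_cplus_swap:
  assumes "i \<in> {1..n+m}" "j \<in> {1..n+m}" "i \<noteq> j" and v: "v \<in> fock n m"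
  shows "cminus n m i (cplus n m j v) = fvscale ((- 1) ^ (\<theta> n i * \<theta> n j)) (cplus n m j (cminus n m i v))"
  using fun_cong[OF W_rel_mixed[OF assms(1-3)], of v] v
  unfolding scomm_fock_End[OF cminus_carrier cplus_carrier] fock_End_simps by simp

text \<open>Reordering c_i^- c_j^+ costs the same sign that the supercommutator attaches to the
  other product. The sign is therefore a common factor, and what is left is an ordinary difference
  of coefficients, one factor of each product being shifted by the operator it passes.\<close>

lemma scomm_diag_cminus_cplus:
  assumes ij: "i \<in> {1..n+m}" "j \<in> {1..n+m}" "i \<noteq> j"
  shows "scomm (fock_End n m) (\<theta> n i) (\<theta> n j)
      (diag n m f \<otimes>\<^bsub>fock_End n m\<^esub> cminus n m i) (diag n m g \<otimes>\<^bsub>fock_End n m\<^esub> cplus n m j)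
    = diag n m (\<lambda>l. (- 1) ^ (\<theta> n i * \<theta> n j) * (f l * g (l(i := l i + 1)) - g l * f (l(j := l j - 1))))
        \<otimes>\<^bsub>fock_End n m\<^esub> (cplus n m j \<otimes>\<^bsub>fock_End n m\<^esub> cminus n m i)"
proof -
  let ?cm = "cminus n m i" and ?cp = "cplus n m j"
  have F: "(diag n m f \<otimes>\<^bsub>fock_End n m\<^esub> ?cm) v l = f l * ?cm v l"
    and G: "(diag n m g \<otimes>\<^bsub>fock_End n m\<^esub> ?cp) v l = g l * ?cp v l" if "v \<in> fock n m" for v l
    by (simp_all add: diag_mult_apply cminus_carrier cplus_carrier that)
  have FG: "?cm ((diag n m g \<otimes>\<^bsub>fock_End n m\<^esub> ?cp) v) l = g (l(i := l i + 1)) * ?cm (?cp v) l"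
    and GF: "?cp ((diag n m f \<otimes>\<^bsub>fock_End n m\<^esub> ?cm) v) l = f (l(j := l j - 1)) * ?cp (?cm v) l"
    if v: "v \<in> fock n m" for v l
  proof -
    have w: "?cp v \<in> fock n m" "?cm v \<in> fock n m"
      by (rule fock_EndD(2)[OF cplus_carrier v] fock_EndD(2)[OF cminus_carrier v])+
    have "?cm (diag n m g (?cp v)) = (diag n m (\<lambda>l. g (l(i := l i + 1))) \<otimes>\<^bsub>fock_End n m\<^esub> ?cm) (?cp v)"
      "?cp (diag n m f (?cm v)) = (diag n m (\<lambda>l. f (l(j := l j - 1))) \<otimes>\<^bsub>fock_End n m\<^esub> ?cp) (?cm v)"
      by (simp_all only: w fock_End_mult_apply flip: cminus_mult_diag cplus_mult_diag)
    then show "?cm ((diag n m g \<otimes>\<^bsub>fock_End n m\<^esub> ?cp) v) l = g (l(i := l i + 1)) * ?cm (?cp v) l"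
      "?cp ((diag n m f \<otimes>\<^bsub>fock_End n m\<^esub> ?cm) v) l = f (l(j := l j - 1)) * ?cp (?cm v) l"
      by (simp_all only: fock_End_mult_apply[OF v] diag_mult_apply[OF cminus_carrier w(1)]
          diag_mult_apply[OF cplus_carrier w(2)])
  qed
  show ?thesis
    unfolding scomm_fock_End[OF fock_End_mult_carrier[OF diag_carrier cminus_carrier]
      fock_End_mult_carrier[OF diag_carrier cplus_carrier]]
  proof (rule extensionalityI[of _ "fock n m"])
    show "diag n m (\<lambda>l. (- 1) ^ (\<theta> n i * \<theta> n j) * (f l * g (l(i := l i + 1)) - g l * f (l(j := l j - 1))))
      \<otimes>\<^bsub>fock_End n m\<^esub> (?cp \<otimes>\<^bsub>fock_End n m\<^esub> ?cm) \<in> extensional (fock n m)"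
      by (intro fock_EndD(1) fock_End_mult_carrier diag_carrier cminus_carrier cplus_carrier)
  next
    fix v assume v: "v \<in> fock n m"
    have w: "(diag n m f \<otimes>\<^bsub>fock_End n m\<^esub> ?cm) v \<in> fock n m"
      "(diag n m g \<otimes>\<^bsub>fock_End n m\<^esub> ?cp) v \<in> fock n m"
      by (rule fock_EndD(2)[OF fock_End_mult_carrier[OF diag_carrier cminus_carrier] v]
          fock_EndD(2)[OF fock_End_mult_carrier[OF diag_carrier cplus_carrier] v])+
    let ?s = "(- 1) ^ (\<theta> n i * \<theta> n j) :: complex fps"
    have "?cm (?cp v) l = ?s * ?cp (?cm v) l" for l
      unfolding cminus_cplus_swap[OF ij v] fvscale_def by (rule refl)
    note sw = this
    have X: "(?cp \<otimes>\<^bsub>fock_End n m\<^esub> ?cm) v = ?cp (?cm v)"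
      by (rule fock_End_mult_apply[OF v])
    show "(\<lambda>v\<in>fock n m. (diag n m f \<otimes>\<^bsub>fock_End n m\<^esub> ?cm) ((diag n m g \<otimes>\<^bsub>fock_End n m\<^esub> ?cp) v)
        - fvscale ?s ((diag n m g \<otimes>\<^bsub>fock_End n m\<^esub> ?cp) ((diag n m f \<otimes>\<^bsub>fock_End n m\<^esub> ?cm) v))) v
      = (diag n m (\<lambda>l. ?s * (f l * g (l(i := l i + 1)) - g l * f (l(j := l j - 1))))
        \<otimes>\<^bsub>fock_End n m\<^esub> (?cp \<otimes>\<^bsub>fock_End n m\<^esub> ?cm)) v"
      by (intro ext) (simp only: restrict_apply' v fun_diff_def fvscale_def sw X F[OF w(2)] G[OF w(1)] FG[OF v] GF[OF v]
          diag_mult_apply[OF fock_End_mult_carrier[OF cplus_carrier cminus_carrier] v],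
        simp only: left_diff_distrib right_diff_distrib mult.assoc mult.left_commute)
  qed simp
qed

text \<open>As a constant diagonal operator the sign can be merged with the other diagonal factors
  and cancelled like them.\<close>

lemma uminus_rsign:
  assumes T: "T \<in> carrier (fock_End n m)"
  shows "\<ominus>\<^bsub>fock_End n m\<^esub> rsign (fock_End n m) d T
    = diag n m (\<lambda>_. - ((- 1) ^ d)) \<otimes>\<^bsub>fock_End n m\<^esub> T"
proof -
  interpret ring "fock_End n m" by (rule ring_fock_End)
  have D: "diag n m (\<lambda>_. - 1) \<otimes>\<^bsub>fock_End n m\<^esub> T = \<ominus>\<^bsub>fock_End n m\<^esub> T"
    unfolding fock_End_uminus[OF T] using fock_EndD(2)[OF T]
    by (auto simp: fock_End_simps compose_def diag_def fun_eq_iff)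
  show ?thesis
  proof (cases "even d")
    case True
    then show ?thesis by (simp add: rsign_def D)
  next
    case False
    then show ?thesis using T by (simp add: rsign_def diag_one)
  qed
qed

section \<open>Occupation sums after a shift, and the coefficient of the commutator\<close>

lemma sum_upd_above: "(\<Sum>k\<in>{1..<i}. (l(j := x)) k) = (\<Sum>k\<in>{1..<i}. l k)"
  if "i \<le> j" for l :: "nat \<Rightarrow> nat"
  using that by (intro sum.cong) auto

lemma sum_upd_Suc: "finite A \<Longrightarrow> i \<in> A \<Longrightarrow> (\<Sum>k\<in>A. (l(i := Suc (l i))) k) = Suc (\<Sum>k\<in>A. l k)"
  for l :: "nat \<Rightarrow> nat"
  by (simp add: sum.remove[of A i])

lemma sum_upd_pred:
  "finite A \<Longrightarrow> j \<in> A \<Longrightarrow> 0 < l j \<Longrightarrow> Suc (\<Sum>k\<in>A. (l(j := l j - Suc 0)) k) = (\<Sum>k\<in>A. l k)"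
  for l :: "nat \<Rightarrow> nat"
  by (simp add: sum.remove[of A j])

lemma sum_split_at:
  "i < j \<Longrightarrow> 1 \<le> i \<Longrightarrow> (\<Sum>k\<in>{1..<j}. l k) = (\<Sum>k\<in>{1..<i}. l k) + l i + (\<Sum>k\<in>{i<..<j}. l k)"
  for l :: "nat \<Rightarrow> nat"
proof -
  assume "i < j" "1 \<le> i"
  then have "{1..<j} = {1..<i} \<union> insert i {i<..<j}" by auto
  moreover have "sum l ({1..<i} \<union> insert i {i<..<j}) = sum l {1..<i} + sum l (insert i {i<..<j})"
    by (rule sum.union_disjoint) auto
  ultimately show ?thesis by simp
qed

text \<open>Together with \<open>hp_plus\<close>, these are the diagonal factors of
  \<open>holstein_primakoff\<close> in front of \<open>cminus\<close> and \<open>cplus\<close>; they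
  instantiate f and g in \<open>scomm_diag_cminus_cplus\<close>.\<close>

definition hp_minus :: "nat \<Rightarrow> nat \<Rightarrow> (int \<Rightarrow> complex fps) \<Rightarrow> nat \<Rightarrow> (nat \<Rightarrow> nat) \<Rightarrow> complex fps"
  where "hp_minus n m s i l =
    qpow (of_nat (\<Sum>k\<in>{1..<i}. l k)) * (qt (of_nat (l i + 1)) * s (int (Ntot n m l)))"

definition hp_plus :: "nat \<Rightarrow> nat \<Rightarrow> (int \<Rightarrow> complex fps) \<Rightarrow> nat \<Rightarrow> (nat \<Rightarrow> nat) \<Rightarrow> complex fps"
  where "hp_plus n m s i l =
    qpow (- of_nat (\<Sum>k\<in>{1..<i}. l k)) * (qt (of_nat (l i)) * s (int (Ntot n m l) - 1))"

text \<open>The square roots combine to \<open>q\<^sup>-\<^sup>1 [p - N] - [p - N + 1]\<close> for \<open>i < j\<close> and to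
  \<open>[p - N] - q\<^sup>-\<^sup>1 [p - N + 1]\<close> for \<open>j < i\<close>, each of which is a single power of \<open>q\<close> up to sign.\<close>

lemma hp_difference_less:
  assumes s: "\<And>k. (s k)\<^sup>2 = qnum (p - of_int k)"
    and ij: "i \<in> {1..n+m}" "j \<in> {1..n+m}" "i < j" and lj: "0 < l j"
  shows "hp_minus n m s i l * hp_plus n m s j (l(i := l i + 1))
      - hp_plus n m s j l * hp_minus n m s i (l(j := l j - 1))
    = - (qpow (p - of_nat (Ntot n m l) - of_nat (l i) - of_nat (\<Sum>k\<in>{i<..<j}. l k))
        * (qt (of_nat (l j)) * qt (of_nat (l i + 1))))"
proof -
  let ?N = "Ntot n m l" and ?a = "of_nat (\<Sum>k\<in>{1..<i}. l k) :: complex"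
    and ?b = "of_nat (\<Sum>k\<in>{1..<j}. l k) :: complex"
    and ?t = "qt (of_nat (l j)) * qt (of_nat (l i + 1))"
  let ?x = "p - of_nat ?N"
  have up: "Ntot n m (l(i := l i + 1)) = Suc ?N"
    using ij by (simp add: Ntot_def sum_upd_Suc del: fun_upd_apply)
  have "Suc (Ntot n m (l(j := l j - 1))) = ?N"
    using ij lj by (simp add: Ntot_def sum_upd_pred del: fun_upd_apply)
  then have down: "int (Ntot n m (l(j := l j - 1))) = int ?N - 1" by simp
  \<comment> \<open>For i < j the sum below j counts l_i, while the sum below i does not count l_j.
    Only the first product gains a factor q^-1, as \<open>qnum_down\<close> requires.\<close>
  have S: "(\<Sum>k\<in>{1..<j}. (l(i := l i + 1)) k) = Suc (\<Sum>k\<in>{1..<j}. l k)"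
    "(\<Sum>k\<in>{1..<i}. (l(j := l j - 1)) k) = (\<Sum>k\<in>{1..<i}. l k)"
    using ij sum_upd_above[of i j l "l j - 1"] by (simp_all add: sum_upd_Suc del: fun_upd_apply)
  have q: "qpow (- of_nat (Suc (\<Sum>k\<in>{1..<j}. l k))) = qpow (- ?b) * qpow (- 1)"
    unfolding qpow_add[symmetric] by (rule arg_cong[of _ _ qpow]) simp
  have sq: "s (int ?N) * s (int ?N) = qnum ?x" "s (int ?N - 1) * s (int ?N - 1) = qnum (?x + 1)"
    using s[of "int ?N"] s[of "int ?N - 1"] by (simp_all add: power2_eq_square algebra_simps)
  have "hp_minus n m s i l * hp_plus n m s j (l(i := l i + 1))
      - hp_plus n m s j l * hp_minus n m s i (l(j := l j - 1))
    = qpow ?a * qpow (- ?b) * ?t *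
      (qpow (- 1) * (s (int ?N) * s (int ?N)) - s (int ?N - 1) * s (int ?N - 1))"
    unfolding hp_minus_def hp_plus_def S up down q using ij by (simp add: algebra_simps)
  also have "\<dots> = - (qpow ?a * qpow (- ?b) * qpow ?x * ?t)"
    unfolding sq qnum_down by simp
  \<comment> \<open>The two prefactors leave only the occupation numbers from i up to j - 1, with
    l_i itself included.\<close>
  also have "qpow ?a * qpow (- ?b) * qpow ?x
      = qpow (?x - of_nat (l i) - of_nat (\<Sum>k\<in>{i<..<j}. l k))"
    using sum_split_at[of i j l] ij by (simp add: algebra_simps flip: qpow_add)
  finally show ?thesis .
qed

lemma hp_difference_greater:
  assumes s: "\<And>k. (s k)\<^sup>2 = qnum (p - of_int k)"
    and ij: "i \<in> {1..n+m}" "j \<in> {1..n+m}" "j < i" and lj: "0 < l j"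
  shows "hp_minus n m s i l * hp_plus n m s j (l(i := l i + 1))
      - hp_plus n m s j l * hp_minus n m s i (l(j := l j - 1))
    = - (qpow (of_nat (l j) + of_nat (\<Sum>k\<in>{j<..<i}. l k) - (p - of_nat (Ntot n m l)) - 1)
        * (qt (of_nat (l j)) * qt (of_nat (l i + 1))))"
proof -
  let ?N = "Ntot n m l" and ?a = "of_nat (\<Sum>k\<in>{1..<i}. l k) :: complex"
    and ?b = "of_nat (\<Sum>k\<in>{1..<j}. l k) :: complex"
    and ?t = "qt (of_nat (l j)) * qt (of_nat (l i + 1))"
  let ?x = "p - of_nat ?N"
  have up: "Ntot n m (l(i := l i + 1)) = Suc ?N"
    using ij by (simp add: Ntot_def sum_upd_Suc del: fun_upd_apply)
  have "Suc (Ntot n m (l(j := l j - 1))) = ?N"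
    using ij lj by (simp add: Ntot_def sum_upd_pred del: fun_upd_apply)
  then have down: "int (Ntot n m (l(j := l j - 1))) = int ?N - 1" by simp
  \<comment> \<open>For j < i it is the sum below i that counts l_j, so the factor q^-1 falls on the
    second product and \<open>qnum_up\<close> applies.\<close>
  have "Suc (\<Sum>k\<in>{1..<i}. (l(j := l j - 1)) k) = (\<Sum>k\<in>{1..<i}. l k)"
    using ij lj by (simp add: sum_upd_pred del: fun_upd_apply)
  then have "of_nat (\<Sum>k\<in>{1..<i}. (l(j := l j - 1)) k) = ?a - 1"
    by (metis add_diff_cancel_left' of_nat_Suc)
  then have q: "qpow (of_nat (\<Sum>k\<in>{1..<i}. (l(j := l j - 1)) k)) = qpow ?a * qpow (- 1)"
    by (simp flip: qpow_add)
  have S: "(\<Sum>k\<in>{1..<j}. (l(i := l i + 1)) k) = (\<Sum>k\<in>{1..<j}. l k)"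
    using ij by (intro sum_upd_above) simp
  have sq: "s (int ?N) * s (int ?N) = qnum ?x" "s (int ?N - 1) * s (int ?N - 1) = qnum (?x + 1)"
    using s[of "int ?N"] s[of "int ?N - 1"] by (simp_all add: power2_eq_square algebra_simps)
  have "hp_minus n m s i l * hp_plus n m s j (l(i := l i + 1))
      - hp_plus n m s j l * hp_minus n m s i (l(j := l j - 1))
    = qpow ?a * qpow (- ?b) * ?t *
      (s (int ?N) * s (int ?N) - qpow (- 1) * (s (int ?N - 1) * s (int ?N - 1)))"
    unfolding hp_minus_def hp_plus_def S up down q using ij by (simp add: algebra_simps)
  also have "\<dots> = - (qpow ?a * qpow (- ?b) * qpow (- ?x - 1) * ?t)"
    unfolding sq qnum_up by simp
  also have "qpow ?a * qpow (- ?b) * qpow (- ?x - 1)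
      = qpow (of_nat (l j) + of_nat (\<Sum>k\<in>{j<..<i}. l k) - ?x - 1)"
    using sum_split_at[of j i l] ij by (simp add: algebra_simps flip: qpow_add)
  finally show ?thesis .
qed


section \<open>The realization of the Cartan-Weyl elements\<close>

lemma ucls_closed: "x \<in> carrier (free_alg (n+m)) \<Longrightarrow> ucls n m x \<in> carrier (Uq n m)"
  by (rule ring_hom_closed[OF ucls_ring_hom])

lemma jacH_word_carrier: "i \<le> r \<Longrightarrow> jacH_word n i \<in> carrier (free_alg r)"
  unfolding jacH_word_def by (intro fsum_carrier fscale_carrier fgen_carrier) (auto simp: gens_def)

lemma jacm_word_carrier: "i \<le> r \<Longrightarrow> jacm_word n i \<in> carrier (free_alg r)"
  by (induction n i rule: jacm_word.induct)
    (auto intro!: fcomm_carrier fgen_carrier simp: gens_def, simp add: free_alg_carrier)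

lemma jacp_word_carrier: "i \<le> r \<Longrightarrow> jacp_word n i \<in> carrier (free_alg r)"
  by (induction n i rule: jacp_word.induct)
    (auto intro!: fcomm_carrier fgen_carrier simp: gens_def, simp add: free_alg_carrier)

lemma jac_closed:
  assumes "i \<le> n + m"
  shows "uL n m i \<in> carrier (Uq n m)" "uLbar n m i \<in> carrier (Uq n m)"
    "uam n m i \<in> carrier (Uq n m)" "uap n m i \<in> carrier (Uq n m)"
proof -
  have "- jacH_word n i = fscale (- 1) (jacH_word n i)" by (simp add: fscale_def fun_eq_iff)
  then have "- jacH_word n i \<in> carrier (free_alg (n + m))"
    by (simp add: fscale_carrier jacH_word_carrier assms)
  then show "uL n m i \<in> carrier (Uq n m)" "uLbar n m i \<in> carrier (Uq n m)"
    "uam n m i \<in> carrier (Uq n m)" "uap n m i \<in> carrier (Uq n m)"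
    using assms unfolding uL_def uLbar_def uam_def uap_def
    by (auto intro!: ucls_closed fqpow_carrier jacH_word_carrier jacm_word_carrier jacp_word_carrier)
qed

section \<open>Solving the defining relations for the images of the Cartan-Weyl elements\<close>

context
  fixes n m p s \<rho> e
  assumes s: "\<And>k. (s k)\<^sup>2 = qnum (p - of_int k)"
    and cw: "cartan_weyl n m e"
    and hp: "holstein_primakoff n m p s \<rho>"
begin

lemma fock_rep: "fock_rep n m \<rho>"
  using hp by (simp add: holstein_primakoff_def)

lemma rep_uam:
  "i \<in> {1..n+m} \<Longrightarrow> \<rho> (uam n m i) = diag n m (hp_minus n m s i) \<otimes>\<^bsub>fock_End n m\<^esub> cminus n m i"
  unfolding hp_minus_def
  by (rule hp[unfolded holstein_primakoff_def, THEN conjunct2, rule_format, THEN conjunct2, THEN conjunct1])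

lemma rep_uap:
  "i \<in> {1..n+m} \<Longrightarrow> \<rho> (uap n m i) = diag n m (hp_plus n m s i) \<otimes>\<^bsub>fock_End n m\<^esub> cplus n m i"
  unfolding hp_plus_def
  by (rule hp[unfolded holstein_primakoff_def, THEN conjunct2, rule_format, THEN conjunct2, THEN conjunct2])

lemma rep_uH:
  "i \<in> {1..n+m} \<Longrightarrow> \<rho> (ucls n m (jacH_word n i))
    = diag n m (\<lambda>l. fps_const (p - sg n i * of_nat (l i) - of_nat (Ntot n m l)))"
  unfolding uH_def[symmetric]
  by (rule hp[unfolded holstein_primakoff_def, THEN conjunct2, rule_format, THEN conjunct1])

text \<open>Only the image of H_i is prescribed. It acts by constants free of h, so
  \<open>word_fqpow_diag\<close> gives its exponential.\<close>

lemma rep_uL: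
  "i \<in> {1..n+m} \<Longrightarrow> \<rho> (uL n m i) = diag n m (\<lambda>l. qpow (p - sg n i * of_nat (l i) - of_nat (Ntot n m l)))"
  unfolding uL_def by (rule word_fqpow_diag[OF fock_rep jacH_word_carrier rep_uH]) auto

lemma rep_uLbar:
  "i \<in> {1..n+m} \<Longrightarrow> \<rho> (uLbar n m i) = diag n m (\<lambda>l. qpow (- (p - sg n i * of_nat (l i) - of_nat (Ntot n m l))))"
  unfolding uLbar_def by (rule word_fqpow_uminus_diag[OF fock_rep jacH_word_carrier rep_uH]) auto

lemma rep_scomm_jacobson:
  assumes "i \<in> {1..n+m}" "j \<in> {1..n+m}" "i \<noteq> j"
  shows "\<rho> (scomm (Uq n m) (\<theta> n i) (\<theta> n j) (uam n m i) (uap n m j))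
    = diag n m (\<lambda>l. (- 1) ^ (\<theta> n i * \<theta> n j) *
        (hp_minus n m s i l * hp_plus n m s j (l(i := l i + 1))
          - hp_plus n m s j l * hp_minus n m s i (l(j := l j - 1))))
        \<otimes>\<^bsub>fock_End n m\<^esub> (cplus n m j \<otimes>\<^bsub>fock_End n m\<^esub> cminus n m i)"
proof -
  have "i \<le> n + m" "j \<le> n + m" using assms by auto
  then have "\<rho> (scomm (Uq n m) (\<theta> n i) (\<theta> n j) (uam n m i) (uap n m j))
      = scomm (fock_End n m) (\<theta> n i) (\<theta> n j) (\<rho> (uam n m i)) (\<rho> (uap n m j))"
    by (intro rep_scomm[OF fock_rep] jac_closed)
  then show ?thesis
    unfolding rep_uam[OF assms(1)] rep_uap[OF assms(2)] scomm_diag_cminus_cplus[OF assms] .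
qed

lemma rep_uminus_rsign:
  assumes u: "u \<in> carrier (Uq n m)"
  shows "\<rho> (\<ominus>\<^bsub>Uq n m\<^esub> rsign (Uq n m) d u) = diag n m (\<lambda>_. - ((- 1) ^ d)) \<otimes>\<^bsub>fock_End n m\<^esub> \<rho> u"
proof -
  interpret ring_hom_ring "Uq n m" "fock_End n m" \<rho>
    by (intro ring_hom_ringI2 ring_Uq ring_fock_End rep_ring_hom[OF fock_rep])
  have "rsign (Uq n m) d u \<in> carrier (Uq n m)" using u by (simp add: rsign_def)
  then show ?thesis
    using u by (simp add: rep_rsign[OF fock_rep] uminus_rsign)
qed

text \<open>L_i stands to the left of the unknown element, so its inverse multiplies the commutator
  from the left and no coefficient is shifted.\<close>

lemma rep_cartan_weyl_less:
  assumes i: "i \<in> {1..n+m}" and j: "j \<in> {1..n+m}" and ij: "i < j"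
  shows "\<rho> (e j i) =
      diag n m (\<lambda>l. qpow (- (2 * of_nat (\<theta> n i) * of_nat (l i) + of_nat (\<Sum>k\<in>{i<..<j}. l k)))
                    * (qt (of_nat (l j)) * qt (of_nat (l i + 1))))
        \<otimes>\<^bsub>fock_End n m\<^esub> (cplus n m j \<otimes>\<^bsub>fock_End n m\<^esub> cminus n m i)"
proof -
  interpret E: ring "fock_End n m" by (rule ring_fock_End)
  interpret U: ring "Uq n m" by (rule ring_Uq)
  note [simp] = diag_carrier cminus_carrier cplus_carrier
  let ?L = "\<lambda>l. p - sg n i * of_nat (l i) - of_nat (Ntot n m l)"
  let ?X = "cplus n m j \<otimes>\<^bsub>fock_End n m\<^esub> cminus n m i"
  let ?\<sigma> = "- ((- 1) ^ \<theta> n i) :: complex fps"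
  have ne: "i \<noteq> j" using ij by simp
  have e: "e j i \<in> carrier (Uq n m)"
    by (rule cw[unfolded cartan_weyl_def, THEN conjunct2, THEN conjunct1, rule_format, OF i j ne])
  then have re [simp]: "\<rho> (e j i) \<in> carrier (fock_End n m)" by (rule rep_closed[OF fock_rep])
  have L: "uL n m i \<in> carrier (Uq n m)" using i by (simp add: jac_closed)
  have eq: "scomm (Uq n m) (\<theta> n i) (\<theta> n j) (uam n m i) (uap n m j)
      = \<ominus>\<^bsub>Uq n m\<^esub> rsign (Uq n m) (\<theta> n i) (uL n m i \<otimes>\<^bsub>Uq n m\<^esub> e j i)"
    by (rule cw[unfolded cartan_weyl_def, THEN conjunct2, THEN conjunct2, THEN conjunct1, rule_format, OF i j ij])
  have "diag n m (\<lambda>_. ?\<sigma>) \<otimes>\<^bsub>fock_End n m\<^esub> (diag n m (\<lambda>l. qpow (?L l)) \<otimes>\<^bsub>fock_End n m\<^esub> \<rho> (e j i))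
      = \<rho> (scomm (Uq n m) (\<theta> n i) (\<theta> n j) (uam n m i) (uap n m j))"
    unfolding eq using rep_uminus_rsign[OF U.m_closed[OF L e]]
    by (simp add: ring_hom_mult[OF rep_ring_hom[OF fock_rep] L e] rep_uL[OF i])
  note eq' = this[unfolded rep_scomm_jacobson[OF i j ne]]
  have "\<rho> (e j i) = diag n m (\<lambda>l. qpow (- ?L l) * ?\<sigma>) \<otimes>\<^bsub>fock_End n m\<^esub>
      (diag n m (\<lambda>_. ?\<sigma>) \<otimes>\<^bsub>fock_End n m\<^esub> (diag n m (\<lambda>l. qpow (?L l)) \<otimes>\<^bsub>fock_End n m\<^esub> \<rho> (e j i)))"
  proof -
    have "(\<lambda>l. qpow (- ?L l) * ?\<sigma> * (?\<sigma> * qpow (?L l))) = (\<lambda>_. 1)"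
    proof
      fix l
      have "?\<sigma> * ?\<sigma> = 1" by (simp flip: power_add mult_2)
      moreover have "qpow (- ?L l) * ?\<sigma> * (?\<sigma> * qpow (?L l)) = qpow (- ?L l) * (?\<sigma> * ?\<sigma>) * qpow (?L l)"
        by (simp only: mult.assoc)
      ultimately have "qpow (- ?L l) * ?\<sigma> * (?\<sigma> * qpow (?L l)) = qpow (- ?L l) * qpow (?L l)"
        by (simp only: mult_1_right)
      then show "qpow (- ?L l) * ?\<sigma> * (?\<sigma> * qpow (?L l)) = 1" by (simp only: qpow_uminus_mult)
    qed
    then show ?thesis
      by (simp only: E.m_assoc[symmetric] diag_mult diag_carrier re E.m_closed diag_one E.l_one)
  qed
  also have "\<dots> = diag n m (\<lambda>l. qpow (- ?L l) * ?\<sigma> * ((- 1) ^ (\<theta> n i * \<theta> n j) *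
        (hp_minus n m s i l * hp_plus n m s j (l(i := l i + 1))
          - hp_plus n m s j l * hp_minus n m s i (l(j := l j - 1))))) \<otimes>\<^bsub>fock_End n m\<^esub> ?X"
    unfolding eq'
    by (simp only: E.m_assoc[symmetric] diag_mult diag_carrier E.m_closed cminus_carrier cplus_carrier)
  also have "\<dots> = diag n m (\<lambda>l. qpow (- (2 * of_nat (\<theta> n i) * of_nat (l i) + of_nat (\<Sum>k\<in>{i<..<j}. l k)))
                    * (qt (of_nat (l j)) * qt (of_nat (l i + 1)))) \<otimes>\<^bsub>fock_End n m\<^esub> ?X"
  proof (rule diag_cplus_cong[OF cminus_carrier])
    fix l :: "nat \<Rightarrow> nat" assume lj: "0 < l j"
    let ?t = "qt (of_nat (l j)) * qt (of_nat (l i + 1))"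
      and ?y = "p - of_nat (Ntot n m l) - of_nat (l i) - of_nat (\<Sum>k\<in>{i<..<j}. l k)"
    \<comment> \<open>The degrees increase with the index, so for i < j the product of the two
      degrees is that of i. The resulting -1 absorbs the minus sign of
      \<open>hp_difference_less\<close>.\<close>
    have sig: "?\<sigma> * (- 1) ^ (\<theta> n i * \<theta> n j) = - 1"
      using ij by (auto simp: \<theta>_def)
    have "qpow (- ?L l) * ?\<sigma> * ((- 1) ^ (\<theta> n i * \<theta> n j) * (- (qpow ?y * ?t)))
        = (?\<sigma> * (- 1) ^ (\<theta> n i * \<theta> n j)) * - (qpow (- ?L l) * qpow ?y * ?t)"
      by (simp only: mult.assoc mult.commute mult.left_commute mult_minus_right mult_minus_left)
    also have "\<dots> = qpow (- ?L l + ?y) * ?t"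
      unfolding sig qpow_add by simp
    \<comment> \<open>Here p - N cancels and (-1)^(\<open>\<theta> n i\<close>) l_i - l_i remains:
      zero for a bosonic index and -2 l_i for a fermionic one. This is the origin of the factor 2 in
      the exponent.\<close>
    also have "- ?L l + ?y = - (2 * of_nat (\<theta> n i) * of_nat (l i) + of_nat (\<Sum>k\<in>{i<..<j}. l k))"
      by (simp add: sg_def \<theta>_def)
    finally show "qpow (- ?L l) * ?\<sigma> * ((- 1) ^ (\<theta> n i * \<theta> n j) *
        (hp_minus n m s i l * hp_plus n m s j (l(i := l i + 1))
          - hp_plus n m s j l * hp_minus n m s i (l(j := l j - 1))))
      = qpow (- (2 * of_nat (\<theta> n i) * of_nat (l i) + of_nat (\<Sum>k\<in>{i<..<j}. l k))) * ?t"
      unfolding hp_difference_less[where s = s and p = p and l = l, OF s i j ij lj] .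
  qed
  finally show ?thesis .
qed

text \<open>Now the inverse of L_j stands to the right of the unknown element. Cancelling it leaves
  a diagonal factor behind c_j^+ c_i^-, and moving that factor to the front replaces l_j by l_j - 1;
  hence N_j - 1 in the exponent.\<close>

lemma rep_cartan_weyl_greater:
  assumes i: "i \<in> {1..n+m}" and j: "j \<in> {1..n+m}" and ij: "j < i"
  shows "\<rho> (e j i) =
      diag n m (\<lambda>l. qpow (2 * of_nat (\<theta> n j) * (of_nat (l j) - 1) + of_nat (\<Sum>k\<in>{j<..<i}. l k))
                    * (qt (of_nat (l j)) * qt (of_nat (l i + 1))))
        \<otimes>\<^bsub>fock_End n m\<^esub> (cplus n m j \<otimes>\<^bsub>fock_End n m\<^esub> cminus n m i)"
proof -
  interpret E: ring "fock_End n m" by (rule ring_fock_End)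
  interpret U: ring "Uq n m" by (rule ring_Uq)
  note [simp] = diag_carrier cminus_carrier cplus_carrier
  let ?L = "\<lambda>l. p - sg n j * of_nat (l j) - of_nat (Ntot n m l)"
  let ?X = "cplus n m j \<otimes>\<^bsub>fock_End n m\<^esub> cminus n m i"
  let ?\<sigma> = "- ((- 1) ^ \<theta> n j) :: complex fps"
  let ?g = "\<lambda>l. (- 1) ^ (\<theta> n i * \<theta> n j) *
        (hp_minus n m s i l * hp_plus n m s j (l(i := l i + 1))
          - hp_plus n m s j l * hp_minus n m s i (l(j := l j - 1)))"
  \<comment> \<open>The nested update is what results from passing c_i^- and then c_j^+, in the form
    produced by \<open>cminus_mult_diag\<close> and \<open>cplus_mult_diag\<close>.\<close>
  let ?shift = "\<lambda>l. (l(j := l j - 1))(i := (l(j := l j - 1)) i + 1)"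
  have ne: "i \<noteq> j" using ij by simp
  have e: "e j i \<in> carrier (Uq n m)"
    by (rule cw[unfolded cartan_weyl_def, THEN conjunct2, THEN conjunct1, rule_format, OF i j ne])
  then have re [simp]: "\<rho> (e j i) \<in> carrier (fock_End n m)" by (rule rep_closed[OF fock_rep])
  have L: "uLbar n m j \<in> carrier (Uq n m)" using j by (simp add: jac_closed)
  have eq: "scomm (Uq n m) (\<theta> n i) (\<theta> n j) (uam n m i) (uap n m j)
      = \<ominus>\<^bsub>Uq n m\<^esub> rsign (Uq n m) (\<theta> n j) (e j i \<otimes>\<^bsub>Uq n m\<^esub> uLbar n m j)"
    by (rule cw[unfolded cartan_weyl_def, THEN conjunct2, THEN conjunct2, THEN conjunct2, rule_format, OF i j ij])
  have "diag n m (\<lambda>_. ?\<sigma>) \<otimes>\<^bsub>fock_End n m\<^esub> (\<rho> (e j i) \<otimes>\<^bsub>fock_End n m\<^esub> diag n m (\<lambda>l. qpow (- ?L l)))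
      = \<rho> (scomm (Uq n m) (\<theta> n i) (\<theta> n j) (uam n m i) (uap n m j))"
    unfolding eq using rep_uminus_rsign[OF U.m_closed[OF e L]]
    by (simp only: ring_hom_mult[OF rep_ring_hom[OF fock_rep] e L] rep_uLbar[OF j])
  note eq' = this[unfolded rep_scomm_jacobson[OF i j ne]]
  have XL: "?X \<otimes>\<^bsub>fock_End n m\<^esub> diag n m (\<lambda>l. qpow (?L l))
      = diag n m (\<lambda>l. qpow (?L (?shift l))) \<otimes>\<^bsub>fock_End n m\<^esub> ?X"
  proof -
    have "?X \<otimes>\<^bsub>fock_End n m\<^esub> diag n m (\<lambda>l. qpow (?L l))
        = cplus n m j \<otimes>\<^bsub>fock_End n m\<^esub> (diag n m (\<lambda>l. qpow (?L (l(i := l i + 1)))) \<otimes>\<^bsub>fock_End n m\<^esub> cminus n m i)"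
      by (simp only: E.m_assoc diag_carrier cminus_carrier cplus_carrier cminus_mult_diag)
    also have "\<dots> = diag n m (\<lambda>l. qpow (?L (?shift l))) \<otimes>\<^bsub>fock_End n m\<^esub> cplus n m j \<otimes>\<^bsub>fock_End n m\<^esub> cminus n m i"
      by (simp only: E.m_assoc[symmetric] diag_carrier cminus_carrier cplus_carrier cplus_mult_diag)
    also have "\<dots> = diag n m (\<lambda>l. qpow (?L (?shift l))) \<otimes>\<^bsub>fock_End n m\<^esub> ?X"
      by (simp only: E.m_assoc diag_carrier cminus_carrier cplus_carrier)
    finally show ?thesis .
  qed
  have "\<rho> (e j i) = diag n m (\<lambda>_. ?\<sigma>) \<otimes>\<^bsub>fock_End n m\<^esub>
      (diag n m (\<lambda>_. ?\<sigma>) \<otimes>\<^bsub>fock_End n m\<^esub> (\<rho> (e j i) \<otimes>\<^bsub>fock_End n m\<^esub> diag n m (\<lambda>l. qpow (- ?L l))))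
      \<otimes>\<^bsub>fock_End n m\<^esub> diag n m (\<lambda>l. qpow (?L l))"
  proof -
    have "?\<sigma> * ?\<sigma> = 1" by (simp flip: power_add mult_2)
    then have 1: "diag n m (\<lambda>_. ?\<sigma>) \<otimes>\<^bsub>fock_End n m\<^esub> diag n m (\<lambda>_. ?\<sigma>) = \<one>\<^bsub>fock_End n m\<^esub>"
      by (simp only: diag_mult diag_one)
    have 2: "diag n m (\<lambda>l. qpow (- ?L l)) \<otimes>\<^bsub>fock_End n m\<^esub> diag n m (\<lambda>l. qpow (?L l)) = \<one>\<^bsub>fock_End n m\<^esub>"
      by (simp only: diag_mult qpow_uminus_mult diag_one)
    have "D \<otimes>\<^bsub>fock_End n m\<^esub> (D \<otimes>\<^bsub>fock_End n m\<^esub> (T \<otimes>\<^bsub>fock_End n m\<^esub> A)) \<otimes>\<^bsub>fock_End n m\<^esub> B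
        = (D \<otimes>\<^bsub>fock_End n m\<^esub> D) \<otimes>\<^bsub>fock_End n m\<^esub> (T \<otimes>\<^bsub>fock_End n m\<^esub> (A \<otimes>\<^bsub>fock_End n m\<^esub> B))"
      if "D \<in> carrier (fock_End n m)" "T \<in> carrier (fock_End n m)"
        "A \<in> carrier (fock_End n m)" "B \<in> carrier (fock_End n m)" for D T A B
      using that by (simp only: E.m_assoc E.m_closed)
    then show ?thesis
      by (simp only: 1 2 diag_carrier re E.r_one E.l_one)
  qed
  also have "\<dots> = diag n m (\<lambda>l. ?\<sigma> * ?g l * qpow (?L (?shift l))) \<otimes>\<^bsub>fock_End n m\<^esub> ?X"
  proof -
    have "diag n m (\<lambda>_. ?\<sigma>) \<otimes>\<^bsub>fock_End n m\<^esub> (diag n m ?g \<otimes>\<^bsub>fock_End n m\<^esub> ?X)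
          \<otimes>\<^bsub>fock_End n m\<^esub> diag n m (\<lambda>l. qpow (?L l))
        = (diag n m (\<lambda>_. ?\<sigma>) \<otimes>\<^bsub>fock_End n m\<^esub> diag n m ?g)
          \<otimes>\<^bsub>fock_End n m\<^esub> (?X \<otimes>\<^bsub>fock_End n m\<^esub> diag n m (\<lambda>l. qpow (?L l)))"
      by (simp only: E.m_assoc E.m_closed diag_carrier cminus_carrier cplus_carrier)
    also have "\<dots> = ((diag n m (\<lambda>_. ?\<sigma>) \<otimes>\<^bsub>fock_End n m\<^esub> diag n m ?g)
          \<otimes>\<^bsub>fock_End n m\<^esub> diag n m (\<lambda>l. qpow (?L (?shift l)))) \<otimes>\<^bsub>fock_End n m\<^esub> ?X"
      unfolding XL by (simp only: E.m_assoc E.m_closed diag_carrier cminus_carrier cplus_carrier)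
    finally show ?thesis unfolding eq' diag_mult .
  qed
  also have "\<dots> = diag n m (\<lambda>l. qpow (2 * of_nat (\<theta> n j) * (of_nat (l j) - 1) + of_nat (\<Sum>k\<in>{j<..<i}. l k))
                    * (qt (of_nat (l j)) * qt (of_nat (l i + 1)))) \<otimes>\<^bsub>fock_End n m\<^esub> ?X"
  proof (rule diag_cplus_cong[OF cminus_carrier])
    fix l :: "nat \<Rightarrow> nat" assume lj: "0 < l j"
    let ?t = "qt (of_nat (l j)) * qt (of_nat (l i + 1))"
      and ?y = "of_nat (l j) + of_nat (\<Sum>k\<in>{j<..<i}. l k) - (p - of_nat (Ntot n m l)) - 1"
    have sig: "?\<sigma> * (- 1) ^ (\<theta> n i * \<theta> n j) = - 1"
      using ij by (auto simp: \<theta>_def)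
    \<comment> \<open>c_j^+ c_i^- conserves the total number. On coordinates this needs 0 < l_j, as
      otherwise the truncated lowering would not balance the raising.\<close>
    have "Suc (Ntot n m (l(j := l j - 1))) = Ntot n m l"
      using j lj by (simp add: Ntot_def sum_upd_pred del: fun_upd_apply)
    moreover have "Ntot n m (?shift l) = Suc (Ntot n m (l(j := l j - 1)))"
      unfolding Ntot_def Suc_eq_plus1[symmetric] by (rule sum_upd_Suc) (use i in auto)
    ultimately have N: "Ntot n m (?shift l) = Ntot n m l" by simp
    have lj': "of_nat (?shift l j) = (of_nat (l j) - 1 :: complex)"
      using ij lj by (simp add: of_nat_diff)
    have "?\<sigma> * ((- 1) ^ (\<theta> n i * \<theta> n j) * (- (qpow ?y * ?t))) * qpow (?L (?shift l))
        = (?\<sigma> * (- 1) ^ (\<theta> n i * \<theta> n j)) * - (qpow ?y * qpow (?L (?shift l)) * ?t)"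
      by (simp only: mult.assoc mult.commute mult.left_commute mult_minus_right mult_minus_left)
    also have "\<dots> = qpow (?y + ?L (?shift l)) * ?t"
      unfolding sig qpow_add by simp
    \<comment> \<open>p - N cancels again; the -1 in \<open>?y\<close> joins l_j, and (l_j - 1)(1 -
      (-1)^(\<open>\<theta> n j\<close>)) is left beside the sum over the indices in
      between.\<close>
    also have "?y + ?L (?shift l)
        = 2 * of_nat (\<theta> n j) * (of_nat (l j) - 1) + of_nat (\<Sum>k\<in>{j<..<i}. l k)"
      unfolding N lj' by (simp add: sg_def \<theta>_def)
    finally show "?\<sigma> * ?g l * qpow (?L (?shift l))
      = qpow (2 * of_nat (\<theta> n j) * (of_nat (l j) - 1) + of_nat (\<Sum>k\<in>{j<..<i}. l k)) * ?t"
      unfolding hp_difference_greater[where s = s and p = p and l = l, OF s i j ij lj] .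
  qed
  finally show ?thesis .
qed

end

theorem mainTheorem7:
  fixes n m :: nat and p :: complex and s :: "int \<Rightarrow> complex fps"
    and e :: "nat \<Rightarrow> nat \<Rightarrow> fel set" and \<rho> :: "fel set \<Rightarrow> fvec \<Rightarrow> fvec"
  assumes "1 \<le> n + m"
    and "\<forall>k. (s k)\<^sup>2 = qnum (p - of_int k)"
    and "cartan_weyl n m e"
    and "holstein_primakoff n m p s \<rho>"
  shows "\<forall>i\<in>{1..n+m}. \<forall>j\<in>{1..n+m}.
    (j < i \<longrightarrow> \<rho> (e j i) =
      diag n m (\<lambda>l. qpow (2 * of_nat (\<theta> n j) * (of_nat (l j) - 1) + of_nat (\<Sum>k\<in>{j<..<i}. l k))
                    * (qt (of_nat (l j)) * qt (of_nat (l i + 1))))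
        \<otimes>\<^bsub>fock_End n m\<^esub> (cplus n m j \<otimes>\<^bsub>fock_End n m\<^esub> cminus n m i)) \<and>
    (i < j \<longrightarrow> \<rho> (e j i) =
      diag n m (\<lambda>l. qpow (- (2 * of_nat (\<theta> n i) * of_nat (l i) + of_nat (\<Sum>k\<in>{i<..<j}. l k)))
                    * (qt (of_nat (l j)) * qt (of_nat (l i + 1))))
        \<otimes>\<^bsub>fock_End n m\<^esub> (cplus n m j \<otimes>\<^bsub>fock_End n m\<^esub> cminus n m i))"
proof -
  have s: "\<And>k. (s k)\<^sup>2 = qnum (p - of_int k)" using assms(2) by blast
  note less = rep_cartan_weyl_less[where s = s and p = p, OF s assms(3,4)]
  note greater = rep_cartan_weyl_greater[where s = s and p = p, OF s assms(3,4)]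
  show ?thesis by (intro ballI conjI impI less greater; assumption)
qed

end
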